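(* Let $p\in\mathcal{H}_{n,d}(e)$, i.e. $p$ is a real homogeneous polynomial of degree $d$ in $n$ variables that is hyperbolic with respect to $e\in\mathbb{R}^n$. Then $$\Lambda_+(p,e)=\{u\in\mathbb{R}^n : H_{p,e}(x)[u]\succeq 0 \text{ for all } x\in\mathbb{R}^n\}=\{u\in\mathbb{R}^n : B_{p,e}(x)[u]\succeq 0 \text{ for all } x\in\mathbb{R}^n\}.$$
   Context: A homogeneous polynomial $p\in\mathbb{R}[x_1,\ldots,x_n]$ of degree $d$ is hyperbolic with respect to $e\in\mathbb{R}^n$ if $p(e)>0$ and for every $x\in\mathbb{R}^n$ the univariate polynomial $t\mapsto p(x+te)$ has only real zeros; $\mathcal{H}_{n,d}(e)$ denotes the set of such polynomials. The hyperbolic eigenvalues $\lambda_1(x)\ge\cdots\ge\lambda_d(x)$ of $x$ are the zeros of $t\mapsto p(te-x)$, and the (closed) hyperbolicity cone is $\Lambda_+(p,e)=\{x\in\mathbb{R}^n:\lambda_i(x)\ge 0 \text{ for } i=1,\ldots,d\}$. $D_up(x)=\frac{d}{dt}p(x+tu)|_{t=0}$ is the directional derivative. For $x,u\in\mathbb{R}^n$ put $p_x(t)=p(x+te)$ and $D_up_x(t)=(D_up)(x+te)$. The parameterized Bézoutian $B_{p,e}(x)[u]$ is the $d\times d$ symmetric matrix defined by $$\frac{p_x(t)\,D_up_x(s)-D_up_x(t)\,p_x(s)}{t-s}=\sum_{i,j=1}^d [B_{p,e}(x)[u]]_{ij}\,t^{i-1}s^{j-1}.$$ The parameterized Hermite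 matrix $H_{p,e}(x)[u]$ is the $d\times d$ Hankel matrix $[h_{i+j-1}]_{i,j=1}^d$, where $\frac{D_up_x(t)}{p_x(t)}=\sum_{k\ge1}h_kt^{-k}$ (expansion at infinity). $A\succeq0$ means $A$ is positive semidefinite. *)

theory Defs
  imports
    "HOL-Analysis.Analysis"
    "HOL-Library.Poly_Mapping"
    "HOL-Computational_Algebra.Computational_Algebra"
    "Jordan_Normal_Form.Matrix"
begin

text \<open>
  A polynomial in the variables \<open>x\<^sub>i\<close>, \<open>i :: 'n\<close>, is a finitely supported map from exponent vectors
  to coefficients; the finite type \<open>'n\<close> is the index set of the \<open>n\<close> variables.
\<close>

type_synonym 'n rpoly = "('n \<Rightarrow>\<^sub>0 nat) \<Rightarrow>\<^sub>0 real"

definition rpoly_eval :: "'n::finite rpoly \<Rightarrow> real ^ 'n \<Rightarrow> real" where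
  "rpoly_eval p x =
     (\<Sum>m\<in>Poly_Mapping.keys p. Poly_Mapping.lookup p m * (\<Prod>i\<in>UNIV. vec_nth x i ^ Poly_Mapping.lookup m i))"

definition homogeneous_of_degree :: "nat \<Rightarrow> 'n::finite rpoly \<Rightarrow> bool" where
  "homogeneous_of_degree d p \<longleftrightarrow> (\<forall>m\<in>Poly_Mapping.keys p. (\<Sum>i\<in>UNIV. Poly_Mapping.lookup m i) = d)"

definition dir_deriv :: "real ^ 'n \<Rightarrow> (real ^ 'n \<Rightarrow> real) \<Rightarrow> real ^ 'n \<Rightarrow> real" where
  "dir_deriv u f x = deriv (\<lambda>t. f (x + t *\<^sub>R u)) 0"

text \<open>
  The univariate polynomial \<open>t \<mapsto> f (x + t e)\<close>. It exists, and is then unique, for all functions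
  \<open>f\<close> used below; see \<open>poly_line_poly_eval\<close> and \<open>poly_line_poly_dir_deriv\<close>.
\<close>

definition line_poly :: "(real ^ 'n \<Rightarrow> real) \<Rightarrow> real ^ 'n \<Rightarrow> real ^ 'n \<Rightarrow> real poly" where
  "line_poly f x e = (THE q. \<forall>t. poly q t = f (x + t *\<^sub>R e))"

definition only_real_zeros :: "real poly \<Rightarrow> bool" where
  "only_real_zeros q \<longleftrightarrow> (\<forall>z::complex. poly (map_poly complex_of_real q) z = 0 \<longrightarrow> z \<in> \<real>)"

definition hyperbolic_polys :: "nat \<Rightarrow> real ^ 'n \<Rightarrow> 'n::finite rpoly set" where
  "hyperbolic_polys d e =
     {p. homogeneous_of_degree d p \<and> rpoly_eval p e > 0 \<and>
         (\<forall>x. only_real_zeros (line_poly (rpoly_eval p) x e))}"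

text \<open>
  The zeros of \<open>t \<mapsto> p(t e - x)\<close>, repeated according to multiplicity, in decreasing order. The
  index starts at \<open>0\<close>, so \<open>hyp_eigenvalue p e x i\<close> is \<open>\<lambda>\<^bsub>i+1\<^esub>(x)\<close>.
\<close>

definition hyp_eigenvalue ::
  "'n::finite rpoly \<Rightarrow> real ^ 'n \<Rightarrow> real ^ 'n \<Rightarrow> nat \<Rightarrow> real" where
  "hyp_eigenvalue p e x i =
     rev (sorted_list_of_multiset (proots (line_poly (rpoly_eval p) (- x) e))) ! i"

definition hyperbolicity_cone ::
  "nat \<Rightarrow> 'n::finite rpoly \<Rightarrow> real ^ 'n \<Rightarrow> (real ^ 'n) set" where
  "hyperbolicity_cone d p e = {x. \<forall>i<d. hyp_eigenvalue p e x i \<ge> 0}"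

text \<open>
  In \<open>real poly poly\<close> the outer variable is \<open>t\<close> and the inner one is \<open>s\<close>: \<open>q(t)\<close> is
  \<open>map_poly (\<lambda>c. [:c:]) q\<close>, \<open>q(s)\<close> is \<open>[:q:]\<close>, and \<open>t - s\<close> is \<open>[:- [:0, 1:], 1:]\<close>. The division is
  exact; see \<open>poly_bezout_quotient\<close>.
\<close>

definition bezout_quotient :: "real poly \<Rightarrow> real poly \<Rightarrow> real poly poly" where
  "bezout_quotient q r =
     (map_poly (\<lambda>c. [:c:]) q * [:r:] - map_poly (\<lambda>c. [:c:]) r * [:q:]) div [:- [:0, 1:], 1:]"

text \<open>
  Matrix indices start at \<open>0\<close>, so the entry \<open>(i, j)\<close> of the Bezoutian belongs to \<open>t\<^sup>i s\<^sup>j\<close>, and that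
  of the Hermite matrix is \<open>h\<^bsub>i+j+1\<^esub>\<close>.
\<close>

definition bezoutian_mat ::
  "nat \<Rightarrow> 'n::finite rpoly \<Rightarrow> real ^ 'n \<Rightarrow> real ^ 'n \<Rightarrow> real ^ 'n \<Rightarrow> real mat" where
  "bezoutian_mat d p e x u =
     mat d d (\<lambda>(i, j). coeff (coeff (bezout_quotient (line_poly (rpoly_eval p) x e)
       (line_poly (dir_deriv u (rpoly_eval p)) x e)) i) j)"

text \<open>
  The expansion of \<open>r(t) / q(t)\<close> at infinity is the Laurent series in \<open>z = 1/t\<close> obtained by
  substituting \<open>t = z\<^sup>-\<^sup>1\<close>; the coefficient of \<open>t\<^sup>-\<^sup>k\<close> is then that of \<open>z\<^sup>k\<close>.
\<close>

definition coeff_at_infinity :: "real poly \<Rightarrow> real poly \<Rightarrow> nat \<Rightarrow> real" where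
  "coeff_at_infinity r q k =
     fls_nth (poly (map_poly fls_const r) fls_X_inv / poly (map_poly fls_const q) fls_X_inv) (int k)"

definition hermite_mat ::
  "nat \<Rightarrow> 'n::finite rpoly \<Rightarrow> real ^ 'n \<Rightarrow> real ^ 'n \<Rightarrow> real ^ 'n \<Rightarrow> real mat" where
  "hermite_mat d p e x u =
     mat d d (\<lambda>(i, j). coeff_at_infinity (line_poly (dir_deriv u (rpoly_eval p)) x e)
       (line_poly (rpoly_eval p) x e) (i + j + 1))"

definition psd_mat :: "nat \<Rightarrow> real mat \<Rightarrow> bool" where
  "psd_mat d A \<longleftrightarrow> A \<in> carrier_mat d d \<and> transpose_mat A = A \<and>
     (\<forall>v\<in>carrier_vec d. scalar_prod v (A *\<^sub>v v) \<ge> 0)"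


subsection \<open>The polynomials above are well defined\<close>

lemma line_poly_eqI:
  assumes "\<And>t. poly q t = f (x + t *\<^sub>R e)"
  shows "line_poly f x e = q"
  unfolding line_poly_def
proof (rule the_equality)
  fix r assume "\<forall>t. poly r t = f (x + t *\<^sub>R e)"
  then have "poly r = poly q" using assms by auto
  then show "r = q" by (simp add: poly_eq_poly_eq_iff)
qed (use assms in simp)

lemma poly_line_poly_eval:
  "poly (line_poly (rpoly_eval p) x e) t = rpoly_eval p (x + t *\<^sub>R e)"
proof -
  define q where "q = (\<Sum>m\<in>Poly_Mapping.keys p. [:Poly_Mapping.lookup p m:] *
     (\<Prod>i\<in>UNIV. [:vec_nth x i, vec_nth e i:] ^ Poly_Mapping.lookup m i))"
  have q: "poly q t = rpoly_eval p (x + t *\<^sub>R e)" for t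
    by (simp add: q_def rpoly_eval_def poly_sum poly_prod poly_power)
  then show ?thesis using line_poly_eqI[of q "rpoly_eval p" x e, OF q] by simp
qed

lemma poly_line_poly_dir_deriv:
  "poly (line_poly (dir_deriv u (rpoly_eval p)) x e) t =
     dir_deriv u (rpoly_eval p) (x + t *\<^sub>R e)"
proof -
  define Q :: "real poly poly" where "Q = (\<Sum>m\<in>Poly_Mapping.keys p. [:[:Poly_Mapping.lookup p m:]:] *
     (\<Prod>i\<in>UNIV. [:[:vec_nth x i, vec_nth e i:], [:vec_nth u i:]:] ^ Poly_Mapping.lookup m i))"
  have Q: "poly (poly Q [:s:]) t = rpoly_eval p (x + t *\<^sub>R e + s *\<^sub>R u)" for s t
    by (simp add: Q_def rpoly_eval_def poly_sum poly_prod poly_power algebra_simps)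
  have R: "poly (map_poly (\<lambda>c. poly c t) Q) s = poly (poly Q [:s:]) t" for s t
    by (induction Q) (simp_all add: map_poly_pCons)
  have D: "poly (coeff Q 1) t = dir_deriv u (rpoly_eval p) (x + t *\<^sub>R e)" for t
  proof -
    let ?r = "map_poly (\<lambda>c. poly c t) Q"
    have "((\<lambda>s. rpoly_eval p (x + t *\<^sub>R e + s *\<^sub>R u)) has_field_derivative poly (pderiv ?r) 0) (at 0)"
      using poly_DERIV[of ?r 0] by (simp add: R Q)
    then show ?thesis
      by (simp add: dir_deriv_def DERIV_imp_deriv poly_0_coeff_0 coeff_pderiv coeff_map_poly)
  qed
  then show ?thesis
    using line_poly_eqI[of "coeff Q 1" "dir_deriv u (rpoly_eval p)" x e, OF D] D by simp
qed

lemma poly_bezout_quotient: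
  assumes "t \<noteq> s"
  shows "poly (poly (bezout_quotient q r) [:t:]) s =
     (poly q t * poly r s - poly r t * poly q s) / (t - s)"
proof -
  let ?N = "map_poly (\<lambda>c. [:c:]) q * [:r:] - map_poly (\<lambda>c. [:c:]) r * [:q:] :: real poly poly"
  have C: "poly (map_poly (\<lambda>c. [:c:]) h) [:0, 1:] = h" for h :: "real poly"
    by (induction h) (simp_all add: map_poly_pCons)
  have E: "poly (map_poly (\<lambda>c. [:c:]) h) [:t:] = [:poly h t:]" for h :: "real poly"
    by (induction h) (simp_all add: map_poly_pCons)
  have "poly ?N [:0, 1:] = 0" by (simp add: C)
  then have "[:- [:0, 1:], 1:] dvd ?N" by (simp only: poly_eq_0_iff_dvd)
  then have "[:- [:0, 1:], 1:] * bezout_quotient q r = ?N"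
    unfolding bezout_quotient_def by (rule dvd_mult_div_cancel)
  then have "poly (poly ([:- [:0, 1:], 1:] * bezout_quotient q r) [:t:]) s = poly (poly ?N [:t:]) s"
    by simp
  then have "(t - s) * poly (poly (bezout_quotient q r) [:t:]) s =
      poly q t * poly r s - poly r t * poly q s"
    by (simp add: E algebra_simps)
  with assms show ?thesis by (simp add: field_simps)
qed

end

theory Submission
  imports Defs
begin

text \<open>
  The proof rests on the partial fraction expansion of \<open>D\<^sub>u p\<^sub>x / p\<^sub>x\<close>. Whenever this function has only
  simple poles, \<open>D\<^sub>u p\<^sub>x(t) = \<Sum>\<^sub>\<theta> m\<^sub>\<theta> p\<^sub>x(t) / (t - \<theta>)\<close> over the distinct zeros \<open>\<theta>\<close> of \<open>p\<^sub>x\<close>, both quadratic forms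
  become weighted sums of squares with weights \<open>m\<^sub>\<theta>\<close>: the Hermite form of \<open>v\<close> is
  \<open>\<Sum>\<^sub>\<theta> m\<^sub>\<theta> (\<Sum>\<^sub>i v\<^sub>i \<theta>\<^sup>i)\<^sup>2\<close>, and the Bezoutian form is \<open>\<Sum>\<^sub>\<theta> m\<^sub>\<theta> (\<Sum>\<^sub>i v\<^sub>i c\<^sub>\<theta>\<^sub>,\<^sub>i)\<^sup>2\<close>, where \<open>c\<^sub>\<theta>\<^sub>,\<^sub>i\<close> are the
  coefficients of \<open>p\<^sub>x(t) / (t - \<theta>)\<close>. In both cases the vectors being squared can be separated by linear
  functionals (\<open>power_vector_separates\<close>, \<open>quotient_coeffs_separate\<close>), so each form is positive
  semidefinite exactly when all weights are non-negative.

  If all forms are positive semidefinite, then \<open>u\<close> is in the cone: at \<open>x = u\<close>, Euler's identity shows that the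
  poles are simple and that \<open>m\<^sub>\<theta>\<close> is the eigenvalue \<open>- \<theta>\<close> of \<open>u\<close> times its multiplicity
  (\<open>self_partial_fractions\<close>).

  Conversely let \<open>u\<close> be in the cone. The main point is that \<open>p(x + t e + s u) \<noteq> 0\<close> for \<open>Im t > 0\<close>, \<open>Im s \<ge> 0\<close>
  and all real \<open>x\<close> (\<open>peval_halfplanes_nonzero\<close>), a form of Garding's theorem. For \<open>u\<close> with positive
  eigenvalues it is clear at \<open>x = 0\<close>, and while \<open>x\<close> is moved away from \<open>0\<close> along a segment, no zero \<open>s\<close>
  can cross the real axis by hyperbolicity; the general case follows by perturbing \<open>u\<close>. Hence the
  logarithmic derivative \<open>D\<^sub>u p\<^sub>x / p\<^sub>x\<close> maps the upper half-plane to the closed lower half-plane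
  (\<open>im_line_deriv_nonpos\<close>), which forces its poles to be simple with non-negative residues
  (\<open>simple_pole_of_half_plane\<close>).
\<close>

\<comment> \<open>From here on \<open>smult\<close> is the scalar multiple of a polynomial.\<close>
hide_const (open) Module.smult

section \<open>Real-rooted polynomials and partial fractions\<close>

lemma map_poly_of_real_mult:
  "map_poly complex_of_real (a * b) = map_poly of_real a * map_poly of_real b"
  by (rule poly_eqI) (simp add: coeff_map_poly coeff_mult)

lemma poly_map_poly_of_real:
  "poly (map_poly of_real q) (of_real x :: complex) = of_real (poly q x)"
  by (induction q) (simp_all add: map_poly_pCons)

lemma only_real_zeros_factorD:
  assumes "only_real_zeros (a * b)"
  shows "only_real_zeros b"
  using assms by (auto simp: only_real_zeros_def map_poly_of_real_mult)

lemma only_real_zeros_imp_root: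
  assumes "only_real_zeros q" "degree q > 0"
  shows "\<exists>x. poly q x = 0"
proof -
  have "degree (map_poly complex_of_real q) > 0"
    using assms(2) by (simp add: degree_map_poly)
  then obtain z where z: "poly (map_poly complex_of_real q) z = 0"
    using alg_closed_imp_poly_has_root by blast
  with assms(1) obtain x where "z = of_real x"
    by (auto simp: only_real_zeros_def elim: Reals_cases)
  with z show ?thesis
    by (auto simp: poly_map_poly_of_real)
qed

text \<open>
  A non-zero real polynomial without non-real zeros splits into linear factors over the reals.
\<close>

lemma only_real_zeros_decompose:
  assumes "only_real_zeros q" "q \<noteq> 0"
  shows "smult (lead_coeff q) (\<Prod>x\<in>#proots q. [:-x, 1:]) = q"
  using assms
proof (induction "degree q" arbitrary: q rule: less_induct)
  case less
  show ?case
  proof (cases "degree q = 0")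
    case True
    then obtain c where "q = [:c:]" by (auto elim: degree_eq_zeroE)
    then show ?thesis by simp
  next
    case False
    then obtain x where "poly q x = 0"
      using only_real_zeros_imp_root less.prems by blast
    then obtain r where r: "q = [:-x, 1:] * r"
      by (auto simp: poly_eq_0_iff_dvd)
    have r0: "r \<noteq> 0" using r less.prems by auto
    have "degree q = Suc (degree r)"
      unfolding r using r0 by (subst degree_mult_eq) auto
    moreover have "only_real_zeros r"
      using less.prems(1) only_real_zeros_factorD r by blast
    ultimately have IH: "smult (lead_coeff r) (\<Prod>x\<in>#proots r. [:-x, 1:]) = r"
      using less.hyps[of r] r0 by simp
    have "proots q = add_mset x (proots r)"
      unfolding r using r0 by (subst proots_mult) auto
    moreover have "lead_coeff q = lead_coeff r"
      unfolding r by (simp only: lead_coeff_mult) simp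
    ultimately have "smult (lead_coeff q) (\<Prod>x\<in>#proots q. [:-x, 1:]) =
        [:-x, 1:] * smult (lead_coeff r) (\<Prod>x\<in>#proots r. [:-x, 1:])"
      by (simp add: mult.commute)
    then show ?thesis using IH r by simp
  qed
qed

lemma only_real_zeros_size_proots:
  assumes "only_real_zeros q" "q \<noteq> 0"
  shows "size (proots q) = degree q"
proof -
  have *: "degree (\<Prod>x\<in>#M. [:-x, 1:]) = size M" for M :: "real multiset"
  proof (induction M)
    case (add x M)
    have "(\<Prod>x\<in>#M. [:-x, 1:]) \<noteq> 0" by (auto simp: prod_mset_zero_iff)
    with add show ?case by (simp add: degree_mult_eq del: mult_pCons_left)
  qed simp
  have "degree q = degree (smult (lead_coeff q) (\<Prod>x\<in>#proots q. [:-x, 1:]))"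
    using only_real_zeros_decompose[OF assms] by simp
  also have "\<dots> = size (proots q)" using assms by (simp add: *)
  finally show ?thesis by simp
qed

lemma prod_linear_dvd:
  fixes D :: "real poly"
  assumes "M \<subseteq># proots D" "D \<noteq> 0"
  shows "(\<Prod>x\<in>#M. [:-x, 1:]) dvd D"
  using assms
proof (induction M arbitrary: D)
  case (add x M)
  have "x \<in># proots D" using add.prems(1) by (meson insert_subset_eq_iff)
  then obtain r where r: "D = [:-x, 1:] * r"
    using add.prems by (auto simp: poly_eq_0_iff_dvd)
  have r0: "r \<noteq> 0" using r add.prems by auto
  have "proots D = add_mset x (proots r)"
    unfolding r using r0 by (subst proots_mult) auto
  then have "(\<Prod>x\<in>#M. [:-x, 1:]) dvd r"
    using add r0 by simp
  then show ?case by (simp add: r mult_dvd_mono del: mult_pCons_left)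
qed simp

lemma real_rooted_dvdI:
  assumes "only_real_zeros q" "q \<noteq> 0"
    and "\<And>\<theta>. poly q \<theta> = 0 \<Longrightarrow> [:-\<theta>, 1:] ^ order \<theta> q dvd D"
  shows "q dvd D"
proof (cases "D = 0")
  case False
  have "count (proots q) \<theta> \<le> count (proots D) \<theta>" for \<theta>
  proof (cases "poly q \<theta> = 0")
    case True
    then show ?thesis using assms False by (simp add: order_divides)
  qed (use assms in \<open>simp add: order_0I\<close>)
  then have "(\<Prod>x\<in>#proots q. [:-x, 1:]) dvd D"
    using False by (intro prod_linear_dvd) (auto simp: subseteq_mset_def)
  then have "smult (lead_coeff q) (\<Prod>x\<in>#proots q. [:-x, 1:]) dvd D"
    using assms(2) by (simp add: smult_dvd)
  then show ?thesis using only_real_zeros_decompose[OF assms(1,2)] by simp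
qed simp

lemma linear_factor_quotient:
  fixes p :: "real poly"
  assumes "poly p \<theta> = 0"
  shows "[:-\<theta>, 1:] * (p div [:-\<theta>, 1:]) = p"
  using assms by (intro dvd_mult_div_cancel) (simp add: poly_eq_0_iff_dvd)

lemma linear_power_quotient:
  fixes f :: "real poly"
  shows "([:-\<theta>, 1:] ^ Suc k * f) div [:-\<theta>, 1:] = [:-\<theta>, 1:] ^ k * f"
proof -
  have "[:-\<theta>, 1:] ^ Suc k * f = [:-\<theta>, 1:] * ([:-\<theta>, 1:] ^ k * f)"
    by (simp only: power_Suc mult.assoc)
  then show ?thesis by (metis nonzero_mult_div_cancel_left pCons_eq_0_iff one_neq_zero)
qed

lemma degree_linear_quotient:
  fixes p :: "real poly"
  assumes "poly p \<theta> = 0" "p \<noteq> 0"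
  shows "degree p = Suc (degree (p div [:-\<theta>, 1:]))"
proof -
  have p: "p = [:-\<theta>, 1:] * (p div [:-\<theta>, 1:])"
    using assms(1) by (rule linear_factor_quotient[symmetric])
  then have "p div [:-\<theta>, 1:] \<noteq> 0" using assms(2) by auto
  then show ?thesis by (subst p, subst degree_mult_eq) auto
qed

lemma power_dvd_linear_quotient:
  fixes p :: "real poly"
  assumes "[:-\<theta>, 1:] ^ k dvd p" "poly p \<eta> = 0" "\<eta> \<noteq> \<theta>" "p \<noteq> 0"
  shows "[:-\<theta>, 1:] ^ k dvd p div [:-\<eta>, 1:]"
proof -
  have p: "p = [:-\<eta>, 1:] * (p div [:-\<eta>, 1:])" (is "_ = _ * ?r")
    using assms(2) by (rule linear_factor_quotient[symmetric])
  have r0: "?r \<noteq> 0" using p assms(4) by auto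
  have "order \<theta> p = order \<theta> [:-\<eta>, 1:] + order \<theta> ?r"
    using p assms(4) by (metis order_mult)
  moreover have "order \<theta> [:-\<eta>, 1:] = 0" by (rule order_0I) (use assms in simp)
  ultimately show ?thesis
    using assms(1,4) r0 by (simp add: order_divides)
qed

lemma root_order_factor:
  fixes p :: "real poly"
  assumes "poly p \<theta> = 0" "p \<noteq> 0"
  obtains k f where "p = [:-\<theta>, 1:] ^ Suc k * f" "poly f \<theta> \<noteq> 0" "order \<theta> p = Suc k"
proof -
  obtain f where f: "p = [:-\<theta>, 1:] ^ order \<theta> p * f" "\<not> [:-\<theta>, 1:] dvd f"
    using order_decomp[OF assms(2)] by blast
  have "order \<theta> p > 0" using assms by (simp add: order_gt_0_iff)
  then obtain k where "order \<theta> p = Suc k" by (auto simp: gr0_conv_Suc)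
  with f that show ?thesis by (simp add: poly_eq_0_iff_dvd)
qed

text \<open>
  At each zero of \<open>p\<close> the rational function \<open>q / p\<close> has at most a simple pole, with residue \<open>m \<theta>\<close>.
  The sum runs over the distinct zeros of \<open>p\<close>, and \<open>p div [:-\<theta>, 1:]\<close> stands for \<open>p / (t - \<theta>)\<close>. The
  difference of the two sides is divisible by \<open>p\<close> and of smaller degree than \<open>p\<close>.
\<close>

lemma partial_fractions:
  fixes p q :: "real poly"
  assumes "only_real_zeros p" "p \<noteq> 0"
    and deg: "\<And>j. j \<ge> degree p \<Longrightarrow> coeff q j = 0"
    and loc: "\<And>\<theta>. poly p \<theta> = 0 \<Longrightarrow> \<exists>k f g. p = [:-\<theta>, 1:] ^ Suc k * f \<and> poly f \<theta> \<noteq> 0 \<and>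
        q = [:-\<theta>, 1:] ^ k * g \<and> poly g \<theta> = m \<theta> * poly f \<theta>"
  shows "q = (\<Sum>\<theta> | poly p \<theta> = 0. smult (m \<theta>) (p div [:-\<theta>, 1:]))"
proof -
  define D where "D = q - (\<Sum>\<theta> | poly p \<theta> = 0. smult (m \<theta>) (p div [:-\<theta>, 1:]))"
  have fin: "finite {\<theta>. poly p \<theta> = 0}" using assms(2) by (rule poly_roots_finite)
  have "p dvd D"
  proof (rule real_rooted_dvdI[OF assms(1,2)])
    fix \<theta> assume \<theta>: "poly p \<theta> = 0"
    from loc[OF this] obtain k f g where k: "p = [:-\<theta>, 1:] ^ Suc k * f" "poly f \<theta> \<noteq> 0"
        "q = [:-\<theta>, 1:] ^ k * g" "poly g \<theta> = m \<theta> * poly f \<theta>" by blast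
    have "order \<theta> p = order \<theta> ([:-\<theta>, 1:] ^ Suc k) + order \<theta> f"
      using assms(2) unfolding k(1) by (intro order_mult) simp
    then have ord: "order \<theta> p = Suc k" using order_0I[OF k(2)] by (simp only: order_power_n_n add_0_right)
    \<comment> \<open>The summands that belong to other zeros keep the full factor of \<open>p\<close> at \<open>\<theta>\<close>.\<close>
    have "[:-\<theta>, 1:] ^ Suc k dvd p" unfolding k(1) by (rule dvd_triv_left)
    then have 1: "[:-\<theta>, 1:] ^ Suc k dvd
        (\<Sum>\<eta>\<in>{\<theta>. poly p \<theta> = 0} - {\<theta>}. smult (m \<eta>) (p div [:-\<eta>, 1:]))"
      using assms(2) by (intro dvd_sum dvd_smult power_dvd_linear_quotient) auto
    have "p div [:-\<theta>, 1:] = [:-\<theta>, 1:] ^ k * f"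
      unfolding k(1) by (rule linear_power_quotient)
    then have "q - smult (m \<theta>) (p div [:-\<theta>, 1:]) = [:-\<theta>, 1:] ^ k * (g - smult (m \<theta>) f)"
      using k(3) by (simp add: algebra_simps)
    moreover have "[:-\<theta>, 1:] dvd g - smult (m \<theta>) f"
      using k(4) by (simp add: poly_eq_0_iff_dvd[symmetric])
    ultimately have 2: "[:-\<theta>, 1:] ^ Suc k dvd q - smult (m \<theta>) (p div [:-\<theta>, 1:])"
      by (simp only: power_Suc2 mult_dvd_mono dvd_refl)
    have "D = (q - smult (m \<theta>) (p div [:-\<theta>, 1:])) -
        (\<Sum>\<eta>\<in>{\<theta>. poly p \<theta> = 0} - {\<theta>}. smult (m \<eta>) (p div [:-\<eta>, 1:]))"
      unfolding D_def using fin \<theta> by (subst sum.remove[of _ \<theta>]) auto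
    then show "[:-\<theta>, 1:] ^ order \<theta> p dvd D"
      using 1 2 by (simp only: ord dvd_diff)
  qed
  moreover have "coeff D j = 0" if "j \<ge> degree p" for j
  proof -
    have "coeff (p div [:-\<theta>, 1:]) j = 0" if "poly p \<theta> = 0" for \<theta>
      using degree_linear_quotient[OF that assms(2)] \<open>j \<ge> degree p\<close> by (intro coeff_eq_0) auto
    then show ?thesis using deg[OF that] by (simp add: D_def coeff_sum)
  qed
  ultimately have "D = 0"
    by (metis dvd_imp_degree_le leading_coeff_0_iff)
  then show ?thesis by (simp add: D_def)
qed

section \<open>Zeros in the lower half-plane\<close>

text \<open>
  For zeros \<open>z\<^sub>j\<close> in the open lower half-plane, \<open>G'(0) / G(0) = \<Sum>\<^sub>j - 1 / z\<^sub>j\<close> has non-positive imaginary part.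
  The statement is multiplied by \<open>\<bar>G(0)\<bar>\<^sup>2\<close>, and the proof splits off one zero at a time.
\<close>

lemma im_log_derivative_nonpos:
  fixes G :: "complex poly"
  assumes "\<And>z. Im z \<ge> 0 \<Longrightarrow> poly G z \<noteq> 0"
  shows "Im (poly (pderiv G) 0 * cnj (poly G 0)) \<le> 0"
  using assms
proof (induction "degree G" arbitrary: G rule: less_induct)
  case less
  show ?case
  proof (cases "degree G = 0")
    case True
    then obtain c where "G = [:c:]" by (auto elim: degree_eq_zeroE)
    then show ?thesis by (simp add: pderiv_pCons)
  next
    case False
    then obtain a where a: "poly G a = 0"
      using alg_closed_imp_poly_has_root by blast
    then obtain r where r: "G = [:-a, 1:] * r" by (auto simp: poly_eq_0_iff_dvd)
    have "r \<noteq> 0" using less.prems[of 0] r by auto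
    then have "degree G = Suc (degree r)" unfolding r by (subst degree_mult_eq) auto
    moreover have "poly r z \<noteq> 0" if "Im z \<ge> 0" for z
      using less.prems[OF that] r by auto
    ultimately have IH: "Im (poly (pderiv r) 0 * cnj (poly r 0)) \<le> 0"
      using less.hyps[of r] by simp
    have "Im a < 0" using a less.prems[of a] by force
    have "pderiv G = [:-a, 1:] * pderiv r + r"
      unfolding r by (simp add: pderiv_mult pderiv_pCons del: mult_pCons_left)
    then have dG: "poly (pderiv G) 0 = poly r 0 - a * poly (pderiv r) 0"
      by (simp del: mult_pCons_left)
    have G: "poly G 0 = - (a * poly r 0)" by (simp add: r)
    have "poly (pderiv G) 0 * cnj (poly G 0) =
        (a * cnj a) * (poly (pderiv r) 0 * cnj (poly r 0)) - cnj a * (poly r 0 * cnj (poly r 0))"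
      unfolding dG G complex_cnj_minus complex_cnj_mult by (simp add: algebra_simps)
    also have "Im \<dots> = (cmod a)\<^sup>2 * Im (poly (pderiv r) 0 * cnj (poly r 0)) + Im a * (cmod (poly r 0))\<^sup>2"
      by (simp only: complex_norm_square[symmetric]) simp
    also have "\<dots> \<le> 0"
      using IH \<open>Im a < 0\<close> by (intro add_nonpos_nonpos mult_nonneg_nonpos mult_nonpos_nonneg) auto
    finally show ?thesis .
  qed
qed

text \<open>
  If all zeros of \<open>P\<close> were at distance at least \<open>r\<close> from \<open>a\<close>, the factorization of \<open>P\<close> would bound
  \<open>\<bar>P(a)\<bar>\<close> from below. This gives the continuity of zeros needed below.
\<close>

lemma poly_root_near:
  fixes P :: "complex poly"
  assumes "cmod (poly P a) < cmod (lead_coeff P) * r ^ degree P" "r \<ge> 0"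
  shows "\<exists>z. poly P z = 0 \<and> cmod (a - z) < r"
proof (rule ccontr)
  assume "\<not> ?thesis"
  then have far: "cmod (a - z) \<ge> r" if "poly P z = 0" for z using that by force
  have P0: "P \<noteq> 0" using assms by auto
  have *: "r ^ size M \<le> cmod (poly (\<Prod>x\<in>#M. [:-x, 1:]) a)" if "\<forall>x\<in>#M. cmod (a - x) \<ge> r" for M
    using that
  proof (induction M)
    case (add x M)
    then have "r * r ^ size M \<le> cmod (a - x) * cmod (poly (\<Prod>x\<in>#M. [:-x, 1:]) a)"
      using assms(2) by (intro mult_mono) auto
    then show ?case by (simp add: norm_mult[symmetric] algebra_simps)
  qed simp
  have "cmod (lead_coeff P) * r ^ degree P \<le>
      cmod (lead_coeff P) * cmod (poly (\<Prod>x\<in>#proots P. [:-x, 1:]) a)"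
    using *[of "proots P"] far P0 by (intro mult_left_mono) (auto simp: size_proots_complex)
  also have "\<dots> = cmod (poly (smult (lead_coeff P) (\<Prod>x\<in>#proots P. [:-x, 1:])) a)"
    by (simp add: norm_mult)
  also have "\<dots> = cmod (poly P a)" by (simp only: complex_poly_decompose_multiset)
  finally show False using assms(1) by simp
qed

text \<open>
  Cauchy's bound for the zeros, in a form that is visibly continuous in the coefficients.
\<close>

lemma poly_root_bound:
  fixes P :: "complex poly"
  assumes "poly P z = 0" "P \<noteq> 0" and "degree P = n"
  shows "cmod z \<le> 1 + (\<Sum>i<n. cmod (coeff P i)) / cmod (coeff P n)"
proof (cases "cmod z \<le> 1 \<or> n = 0")
  case True
  have "n \<noteq> 0" using assms by (metis degree_eq_zeroE poly_const_conv pCons_0_0)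
  moreover have "0 \<le> (\<Sum>i<n. cmod (coeff P i)) / cmod (coeff P n)"
    by (intro divide_nonneg_nonneg sum_nonneg) auto
  ultimately show ?thesis using True by linarith
next
  case False
  then have z: "cmod z > 1" and n: "n > 0" by auto
  have "0 = (\<Sum>i\<le>n. coeff P i * z ^ i)" using assms by (simp add: poly_altdef)
  also have "\<dots> = (\<Sum>i<n. coeff P i * z ^ i) + coeff P n * z ^ n"
    by (simp add: lessThan_Suc_atMost[symmetric])
  finally have "coeff P n * z ^ n = - (\<Sum>i<n. coeff P i * z ^ i)"
    by (simp add: eq_neg_iff_add_eq_0 add.commute)
  then have "cmod (coeff P n) * cmod z ^ n = cmod (\<Sum>i<n. coeff P i * z ^ i)"
    by (metis norm_minus_cancel norm_mult norm_power)
  also have "\<dots> \<le> (\<Sum>i<n. cmod (coeff P i) * cmod z ^ (n - 1))"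
  proof (rule order_trans[OF norm_sum], rule sum_mono)
    fix i assume "i \<in> {..<n}"
    then show "cmod (coeff P i * z ^ i) \<le> cmod (coeff P i) * cmod z ^ (n - 1)"
      using z by (auto simp: norm_mult norm_power intro!: mult_left_mono power_increasing)
  qed
  also have "\<dots> = (\<Sum>i<n. cmod (coeff P i)) * cmod z ^ (n - 1)" by (simp add: sum_distrib_right)
  finally have "(cmod (coeff P n) * cmod z) * cmod z ^ (n - 1) \<le> (\<Sum>i<n. cmod (coeff P i)) * cmod z ^ (n - 1)"
    using n by (cases n) (simp_all add: mult_ac)
  then have "cmod (coeff P n) * cmod z \<le> (\<Sum>i<n. cmod (coeff P i))"
  proof (rule mult_right_le_imp_le)
    show "cmod z ^ (n - 1) > 0" by (rule zero_less_power) (use z in linarith)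
  qed
  moreover have "cmod (coeff P n) > 0" using assms(2,3) by auto
  ultimately have "cmod z \<le> (\<Sum>i<n. cmod (coeff P i)) / cmod (coeff P n)"
    by (simp add: field_simps)
  then show ?thesis by simp
qed

text \<open>
  A continuous path of polynomials of constant degree and leading coefficient: zeros move continuously
  and cannot escape to infinity, so if none ever is real, all of them stay in the open lower half-plane.
  The proof shows that the set of parameters with a zero in the closed upper half-plane is open and
  closed in \<open>[0, 1]\<close>.
\<close>

lemma roots_stay_below_real_axis:
  fixes P :: "real \<Rightarrow> complex poly"
  assumes deg: "\<And>b. b \<in> {0..1} \<Longrightarrow> degree (P b) = n"
    and lead: "\<And>b. b \<in> {0..1} \<Longrightarrow> coeff (P b) n = c" "c \<noteq> 0"
    and cont: "\<And>i. continuous_on {0..1} (\<lambda>b. coeff (P b) i)"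
    and noreal: "\<And>b x. b \<in> {0..1} \<Longrightarrow> poly (P b) (of_real x) \<noteq> 0"
    and start: "\<And>z. Im z \<ge> 0 \<Longrightarrow> poly (P 0) z \<noteq> 0"
    and z: "Im z \<ge> 0"
  shows "poly (P 1) z \<noteq> 0"
proof -
  define A where "A = {b \<in> {0..1}. \<exists>z. Im z \<ge> 0 \<and> poly (P b) z = 0}"
  define f where "f = (\<lambda>(b, z). \<Sum>i\<le>n. coeff (P b) i * z ^ i)"
  have f: "poly (P b) z = f (b, z)" if "b \<in> {0..1}" for b z
    using deg[OF that] by (simp add: f_def poly_altdef)
  have contf: "continuous_on ({0..1} \<times> UNIV) f"
    unfolding f_def case_prod_beta
    by (intro continuous_intros continuous_on_compose2[OF cont continuous_on_fst]) auto
  \<comment> \<open>Roots cannot escape to infinity, so \<open>A\<close> is the projection of a compact set.\<close>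
  have "continuous_on {0..1} (\<lambda>b. 1 + (\<Sum>i<n. cmod (coeff (P b) i)) / cmod c)"
    by (intro continuous_intros cont) (use lead in auto)
  then have "compact ((\<lambda>b. 1 + (\<Sum>i<n. cmod (coeff (P b) i)) / cmod c) ` {0..1})"
    by (rule compact_continuous_image) simp
  then obtain R where R: "\<And>b. b \<in> {0..1} \<Longrightarrow> 1 + (\<Sum>i<n. cmod (coeff (P b) i)) / cmod c \<le> R"
    by (meson compact_imp_bounded bounded_imp_bdd_above bdd_above.E imageI)
  define K where "K = ({0..1} \<times> (cball 0 R \<inter> {z. Im z \<ge> 0})) \<inter> f -` {0}"
  have "compact ({0..1::real} \<times> (cball (0::complex) R \<inter> {z. Im z \<ge> 0}))"
    by (intro compact_Times compact_Int_closed closed_halfspace_Im_ge) auto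
  moreover have "closed K"
    unfolding K_def
    by (intro continuous_closed_preimage continuous_on_subset[OF contf] compact_imp_closed calculation) auto
  moreover have "K = ({0..1} \<times> (cball 0 R \<inter> {z. Im z \<ge> 0})) \<inter> K" by (auto simp: K_def)
  ultimately have "compact K" by (metis compact_Int_closed)
  then have "compact (fst ` K)" by (intro compact_continuous_image continuous_intros)
  moreover have "A = fst ` K"
  proof
    show "A \<subseteq> fst ` K"
    proof
      fix b assume "b \<in> A"
      then obtain z where z: "b \<in> {0..1}" "Im z \<ge> 0" "poly (P b) z = 0" by (auto simp: A_def)
      have "P b \<noteq> 0" using lead z(1) by (metis coeff_0)
      then have "cmod z \<le> R"
        using poly_root_bound[OF z(3) _ deg] lead R z(1) by fastforce
      then have "(b, z) \<in> K" using z f by (auto simp: K_def)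
      then show "b \<in> fst ` K" by force
    qed
  qed (use f in \<open>auto simp: K_def A_def\<close>)
  ultimately have closed: "closed A" by (simp add: compact_imp_closed)
  have "openin (top_of_set {0..1}) A"
  proof (subst openin_euclidean_subtopology_iff, safe)
    fix b assume b: "b \<in> A"
    then obtain z where z: "b \<in> {0..1}" "Im z \<ge> 0" "poly (P b) z = 0" by (auto simp: A_def)
    have "Im z \<noteq> 0"
    proof
      assume "Im z = 0"
      then have "z = of_real (Re z)" by (simp add: complex_eq_iff)
      then show False using noreal[OF z(1), of "Re z"] z(3) by simp
    qed
    with z have Imz: "Im z > 0" by simp
    then have pos: "cmod c * Im z ^ n > 0" using lead(2) by simp
    have "continuous_on {0..1} (\<lambda>b. f (b, z))"
      by (intro continuous_on_compose2[OF contf]) (auto intro!: continuous_intros)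
    then obtain \<delta> where \<delta>: "\<delta> > 0" "\<And>b'. b' \<in> {0..1} \<Longrightarrow> dist b' b < \<delta> \<Longrightarrow>
        dist (f (b', z)) (f (b, z)) < cmod c * Im z ^ n"
      using z(1) pos unfolding continuous_on_iff by meson
    have "b' \<in> A" if b': "b' \<in> {0..1}" "dist b' b < \<delta>" for b'
    proof -
      have "cmod (poly (P b') z) < cmod (lead_coeff (P b')) * Im z ^ degree (P b')"
        using \<delta>(2)[OF b'] b' z deg lead by (simp add: f[symmetric])
      then obtain w where w: "poly (P b') w = 0" "cmod (z - w) < Im z"
        using poly_root_near Imz by (meson less_imp_le)
      have "Im z - Im w \<le> cmod (z - w)"
        using abs_Im_le_cmod[of "z - w"] by simp
      with w have "Im w \<ge> 0" by linarith
      with w show ?thesis using b' by (auto simp: A_def)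
    qed
    with \<delta>(1) show "\<exists>e>0. \<forall>x'\<in>{0..1}. dist x' b < e \<longrightarrow> x' \<in> A" by blast
  qed (auto simp: A_def)
  moreover have "closedin (top_of_set {0..1}) A"
    by (rule closed_subset[OF _ closed]) (auto simp: A_def)
  ultimately have "A = {} \<or> A = {0..1}"
    using connected_clopen[of "{0..1::real}"] by auto
  moreover have "0 \<notin> A" using start by (auto simp: A_def)
  ultimately have "1 \<notin> A" by (metis atLeastAtMost_iff empty_iff order_refl zero_le_one)
  then show ?thesis using z by (auto simp: A_def)
qed

section \<open>Real poles of functions that map the upper half-plane to the lower one\<close>

lemma poly_map_poly_of_real_power:
  "poly (map_poly complex_of_real ([:-\<theta>, 1:] ^ k)) z = (z - of_real \<theta>) ^ k"
  by (induction k) (simp_all add: map_poly_of_real_mult map_poly_pCons del: mult_pCons_left)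

text \<open>
  If \<open>q / p\<close> maps the upper half-plane to the closed lower half-plane, its real poles are simple with
  non-negative residues. The hypothesis writes \<open>Im (q / p)\<close> as \<open>Im (q * cnj p)\<close> up to a positive factor.
  A pole of order \<open>n\<close> at \<open>\<theta>\<close> behaves like \<open>c (t - \<theta>)\<^sup>-\<^sup>n\<close>; along the ray \<open>t = \<theta> + \<epsilon> w\<close> the sign of the
  imaginary part is that of \<open>- c Im (w\<^sup>n)\<close>, and for \<open>n \<ge> 2\<close> both signs occur in the upper half-plane.
\<close>
lemma simple_pole_of_half_plane:
  fixes p q f :: "real poly"
  assumes p: "p = [:-\<theta>, 1:] ^ Suc k * f" and f: "poly f \<theta> \<noteq> 0"
    and im: "\<And>t. Im t > 0 \<Longrightarrow>
      Im (poly (map_poly of_real q) t * cnj (poly (map_poly of_real p) t)) \<le> 0"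
  shows "\<exists>g. q = [:-\<theta>, 1:] ^ k * g \<and> poly g \<theta> * poly f \<theta> \<ge> 0"
proof (cases "q = 0")
  case True
  then show ?thesis by (intro exI[of _ 0]) simp
next
  case False
  define l where "l = order \<theta> q"
  obtain q1 where q1: "q = [:-\<theta>, 1:] ^ l * q1" "\<not> [:-\<theta>, 1:] dvd q1"
    using order_decomp[OF False, of \<theta>] by (auto simp: l_def)
  define c where "c = poly q1 \<theta> * poly f \<theta>"
  have "poly q1 \<theta> \<noteq> 0" using q1(2) by (simp add: poly_eq_0_iff_dvd)
  with f have "c \<noteq> 0" by (simp add: c_def)
  have key: "c * Im (w ^ l * cnj w ^ Suc k) \<le> 0" if w: "Im w > 0" for w
  proof -
    define F where "F = (\<lambda>\<epsilon>::real. Im (w ^ l * cnj w ^ Suc k *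
      (poly (map_poly of_real q1) (of_real \<theta> + of_real \<epsilon> * w) *
       cnj (poly (map_poly of_real f) (of_real \<theta> + of_real \<epsilon> * w)))))"
    have "F \<epsilon> \<le> 0" if e: "\<epsilon> > 0" for \<epsilon>
    proof -
      let ?t = "of_real \<theta> + of_real \<epsilon> * w"
      have "poly (map_poly of_real q) ?t * cnj (poly (map_poly of_real p) ?t) =
        of_real (\<epsilon> ^ (l + Suc k)) * (w ^ l * cnj w ^ Suc k *
          (poly (map_poly of_real q1) ?t * cnj (poly (map_poly of_real f) ?t)))"
        unfolding p q1(1) map_poly_of_real_mult poly_mult poly_map_poly_of_real_power
        by (simp add: power_mult_distrib power_add mult_ac)
      then have "Im (poly (map_poly of_real q) ?t * cnj (poly (map_poly of_real p) ?t)) =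
        \<epsilon> ^ (l + Suc k) * F \<epsilon>"
        by (simp only: Im_complex_of_real F_def times_complex.sel Re_complex_of_real)
      moreover have "Im ?t > 0" using e w by simp
      ultimately have "\<epsilon> ^ (l + Suc k) * F \<epsilon> \<le> 0" using im by metis
      moreover have "\<epsilon> ^ (l + Suc k) > 0" using e by (rule zero_less_power)
      ultimately show ?thesis by (metis mult_le_0_iff not_less)
    qed
    then have "eventually (\<lambda>\<epsilon>. F \<epsilon> \<le> 0) (at_right 0)"
      by (simp add: eventually_at_right_less eventually_mono[OF eventually_at_right_less])
    moreover have "continuous_on UNIV F" unfolding F_def by (intro continuous_intros)
    then have "isCont F 0" by (simp add: continuous_on_eq_continuous_at)
    then have "(F \<longlongrightarrow> F 0) (at_right 0)"
      by (meson continuous_at_imp_continuous_at_within continuous_within)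
    ultimately have "F 0 \<le> 0"
      by (intro tendsto_upperbound) auto
    moreover have "F 0 = c * Im (w ^ l * cnj w ^ Suc k)"
    proof -
      have "F 0 = Im (of_real c * (w ^ l * cnj w ^ Suc k))"
        by (simp add: F_def c_def poly_map_poly_of_real mult_ac)
      then show ?thesis by simp
    qed
    ultimately show ?thesis by simp
  qed
  \<comment> \<open>For \<open>l > k\<close> there is no pole, and the weight is \<open>0\<close>.\<close>
  show ?thesis
  proof (cases "l > k")
    case True
    then have "q = [:-\<theta>, 1:] ^ k * ([:-\<theta>, 1:] ^ (l - k) * q1)"
      unfolding q1(1) by (simp only: mult.assoc[symmetric] power_add[symmetric]) simp
    moreover have "poly ([:-\<theta>, 1:] ^ (l - k) * q1) \<theta> = 0"
      using True by (simp add: poly_power)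
    ultimately show ?thesis by (intro exI[of _ "[:-\<theta>, 1:] ^ (l - k) * q1"]) (simp only: mult_zero_left order_refl simp_thms)
  next
    case False
    define n where "n = Suc k - l"
    have n: "n > 0" "Suc k = l + n" using False by (auto simp: n_def)
    have cis: "c * sin (n * \<phi>) \<ge> 0" if "0 < \<phi>" "\<phi> < pi" for \<phi> :: real
    proof -
      have "cis \<phi> ^ l * cnj (cis \<phi>) ^ Suc k = cis (- (n * \<phi>))"
        unfolding n(2) cis_cnj Complex.DeMoivre cis_mult
        by (simp add: algebra_simps)
      then show ?thesis using key[of "cis \<phi>"] that by (simp add: sin_gt_zero)
    qed
    \<comment> \<open>This angle makes the sine equal to \<open>1\<close>; the next one, in the range only for \<open>n \<ge> 2\<close>, to \<open>- 1\<close>.\<close>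
    have "c \<ge> 0" using cis[of "pi / (2 * n)"] n by (simp add: field_simps)
    moreover have "n = 1"
    proof (rule ccontr)
      assume "n \<noteq> 1"
      then have "real n \<ge> 2" using n by simp
      then have "3 * pi / (2 * n) < pi" by (simp add: field_simps)
      moreover have "real n * (3 * pi / (2 * n)) = 3 / 2 * pi" using n by simp
      ultimately have "c * sin (3 / 2 * pi) \<ge> 0" using cis[of "3 * pi / (2 * n)"] n by simp
      then have "c \<le> 0" using sin_3over2_pi by simp
      with \<open>c \<ge> 0\<close> \<open>c \<noteq> 0\<close> show False by simp
    qed
    then have "l = k" using n by simp
    with q1(1) \<open>c \<ge> 0\<close> show ?thesis by (auto simp: c_def)
  qed
qed

section \<open>Quadratic forms that are weighted sums of squares\<close>

lemma quadratic_form_weighted_squares: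
  fixes v :: "real vec"
  assumes "v \<in> carrier_vec d"
  shows "scalar_prod v (mat d d (\<lambda>(i, j). \<Sum>\<theta>\<in>S. m \<theta> * w \<theta> i * w \<theta> j) *\<^sub>v v) =
    (\<Sum>\<theta>\<in>S. m \<theta> * (\<Sum>i<d. vec_index v i * w \<theta> i)\<^sup>2)"
proof -
  have "scalar_prod v (mat d d (\<lambda>(i, j). \<Sum>\<theta>\<in>S. m \<theta> * w \<theta> i * w \<theta> j) *\<^sub>v v) =
    (\<Sum>i<d. \<Sum>j<d. \<Sum>\<theta>\<in>S. m \<theta> * ((vec_index v i * w \<theta> i) * (vec_index v j * w \<theta> j)))"
    using assms
    by (auto simp: scalar_prod_def mult_mat_vec_def lessThan_atLeast0 sum_distrib_left sum_distrib_right
        mult_ac intro!: sum.cong)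
  also have "\<dots> = (\<Sum>i<d. \<Sum>\<theta>\<in>S. \<Sum>j<d. m \<theta> * ((vec_index v i * w \<theta> i) * (vec_index v j * w \<theta> j)))"
    by (intro sum.cong refl sum.swap)
  also have "\<dots> = (\<Sum>\<theta>\<in>S. \<Sum>i<d. \<Sum>j<d. m \<theta> * ((vec_index v i * w \<theta> i) * (vec_index v j * w \<theta> j)))"
    by (rule sum.swap)
  also have "\<dots> = (\<Sum>\<theta>\<in>S. m \<theta> * (\<Sum>i<d. vec_index v i * w \<theta> i)\<^sup>2)"
    unfolding power2_eq_square sum_product by (simp only: sum_distrib_left)
  finally show ?thesis .
qed

lemma psd_mat_weighted_squares:
  assumes "\<And>\<theta>. \<theta> \<in> S \<Longrightarrow> m \<theta> \<ge> 0"
  shows "psd_mat d (mat d d (\<lambda>(i, j). \<Sum>\<theta>\<in>S. m \<theta> * w \<theta> i * w \<theta> j))"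
  unfolding psd_mat_def
proof (intro conjI ballI)
  show "transpose_mat (mat d d (\<lambda>(i, j). \<Sum>\<theta>\<in>S. m \<theta> * w \<theta> i * w \<theta> j)) =
      mat d d (\<lambda>(i, j). \<Sum>\<theta>\<in>S. m \<theta> * w \<theta> i * w \<theta> j)"
    by (rule eq_matI) (simp_all add: mult_ac)
  fix v :: "real vec" assume "v \<in> carrier_vec d"
  then show "scalar_prod v (mat d d (\<lambda>(i, j). \<Sum>\<theta>\<in>S. m \<theta> * w \<theta> i * w \<theta> j) *\<^sub>v v) \<ge> 0"
    by (subst quadratic_form_weighted_squares) (auto intro!: sum_nonneg mult_nonneg_nonneg assms)
qed simp

text \<open>
  The converse direction: a vector orthogonal to all the vectors \<open>w \<theta>\<close> except \<open>w \<eta>\<close> isolates the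
  weight at \<open>\<eta>\<close>.
\<close>

lemma psd_mat_weight_nonneg:
  assumes psd: "psd_mat d (mat d d (\<lambda>(i, j). \<Sum>\<theta>\<in>S. m \<theta> * w \<theta> i * w \<theta> j))"
    and "finite S" "\<eta> \<in> S"
    and zero: "\<And>\<theta>. \<theta> \<in> S \<Longrightarrow> \<theta> \<noteq> \<eta> \<Longrightarrow> (\<Sum>i<d. v i * w \<theta> i) = 0"
    and nonzero: "(\<Sum>i<d. v i * w \<eta> i) \<noteq> 0"
  shows "m \<eta> \<ge> 0"
proof -
  have "0 \<le> scalar_prod (vec d v) (mat d d (\<lambda>(i, j). \<Sum>\<theta>\<in>S. m \<theta> * w \<theta> i * w \<theta> j) *\<^sub>v vec d v)"
    using psd by (auto simp: psd_mat_def)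
  also have "\<dots> = (\<Sum>\<theta>\<in>S. m \<theta> * (\<Sum>i<d. v i * w \<theta> i)\<^sup>2)"
    by (subst quadratic_form_weighted_squares) simp_all
  also have "\<dots> = (\<Sum>\<theta>\<in>{\<eta>}. m \<theta> * (\<Sum>i<d. v i * w \<theta> i)\<^sup>2)"
    by (rule sum.mono_neutral_right) (use assms in auto)
  finally show ?thesis using nonzero by (simp add: zero_le_mult_iff)
qed

section \<open>Expansion at infinity and the Hermite form\<close>

text \<open>
  A polynomial in \<open>t\<close> as a Laurent series in \<open>z = 1/t\<close>.
\<close>

definition at_infinity :: "real poly \<Rightarrow> real fls" where
  "at_infinity f = poly (map_poly fls_const f) fls_X_inv"

lemma coeff_at_infinity_eq: "coeff_at_infinity r q k = fls_nth (at_infinity r / at_infinity q) (int k)"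
  by (simp add: coeff_at_infinity_def at_infinity_def)

lemma at_infinity_pCons: "at_infinity (pCons a f) = fls_const a + fls_X_inv * at_infinity f"
  by (simp add: at_infinity_def map_poly_pCons)

lemma at_infinity_0 [simp]: "at_infinity 0 = 0"
  by (simp add: at_infinity_def)

lemma at_infinity_add: "at_infinity (f + g) = at_infinity f + at_infinity g"
proof (induction f arbitrary: g)
  case (pCons a f)
  obtain b g' where g: "g = pCons b g'" by (cases g) auto
  show ?case by (simp add: g at_infinity_pCons pCons.IH algebra_simps fls_plus_const)
qed simp

lemma at_infinity_smult: "at_infinity (smult c f) = fls_const c * at_infinity f"
  by (induction f) (simp_all add: at_infinity_pCons algebra_simps)

lemma at_infinity_mult: "at_infinity (f * g) = at_infinity f * at_infinity g"
  by (induction f) (simp_all add: at_infinity_pCons at_infinity_add at_infinity_smult algebra_simps)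

lemma at_infinity_sum: "at_infinity (\<Sum>x\<in>A. f x) = (\<Sum>x\<in>A. at_infinity (f x))"
  by (induction A rule: infinite_finite_induct) (simp_all add: at_infinity_add)

lemma at_infinity_nth: "fls_nth (at_infinity f) n = (if n \<le> 0 then coeff f (nat (- n)) else 0)"
proof (induction f arbitrary: n)
  case (pCons a f)
  have "nat (- n) = Suc (nat (- 1 - n))" if "n < 0" using that by simp
  then show ?case
    by (auto simp: at_infinity_pCons fls_X_inv_times_conv_shift pCons.IH algebra_simps)
qed simp

lemma at_infinity_nonzero: "f \<noteq> 0 \<Longrightarrow> at_infinity f \<noteq> 0"
proof
  assume "f \<noteq> 0" "at_infinity f = 0"
  then have "fls_nth (at_infinity f) (- int (degree f)) = 0" by simp
  with \<open>f \<noteq> 0\<close> show False by (simp add: at_infinity_nth)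
qed

text \<open>
  The geometric series \<open>1 / (t - \<theta>) = \<Sum>\<^sub>k \<theta>\<^sup>k t\<^bsup>-k-1\<^esup>\<close>.
\<close>

lemma coeff_at_infinity_linear_quotient:
  assumes "poly p \<theta> = 0" "p \<noteq> 0"
  shows "coeff_at_infinity (p div [:-\<theta>, 1:]) p (Suc k) = \<theta> ^ k"
proof -
  have p: "p = [:-\<theta>, 1:] * (p div [:-\<theta>, 1:])" (is "_ = _ * ?r")
    using assms(1) by (rule linear_factor_quotient[symmetric])
  define g where "g = fps_to_fls (Abs_fps (\<lambda>n. if n = 0 then 0 else \<theta> ^ (n - 1)))"
  have "at_infinity [:-\<theta>, 1:] * g = 1"
  proof (rule fls_eqI)
    fix n :: int
    have "at_infinity [:-\<theta>, 1:] * g = fls_shift 1 g - fls_const \<theta> * g"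
      by (simp add: at_infinity_pCons algebra_simps fls_X_inv_times_conv_shift)
    then have "fls_nth (at_infinity [:-\<theta>, 1:] * g) n = fls_nth g (n + 1) - \<theta> * fls_nth g n"
      by simp
    also have "\<dots> = fls_nth 1 n"
    proof (cases "n \<le> 0")
      case False
      then have "n = int (Suc (nat (n - 1)))" by simp
      then obtain k where "n = int (Suc k)" by blast
      then show ?thesis by (simp add: g_def nat_add_distrib)
    qed (auto simp: g_def)
    finally show "fls_nth (at_infinity [:-\<theta>, 1:] * g) n = fls_nth 1 n" .
  qed
  then have "at_infinity ?r = g * at_infinity p"
    by (subst (2) p) (simp add: at_infinity_mult mult_ac del: mult_pCons_left)
  then have "at_infinity ?r / at_infinity p = g"
    using at_infinity_nonzero[OF assms(2)] by simp
  then show ?thesis by (simp add: coeff_at_infinity_eq g_def nat_add_distrib)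
qed

lemma coeff_at_infinity_partial_fractions:
  assumes "p \<noteq> 0"
  shows "coeff_at_infinity (\<Sum>\<theta> | poly p \<theta> = 0. smult (m \<theta>) (p div [:-\<theta>, 1:])) p (Suc k) =
    (\<Sum>\<theta> | poly p \<theta> = 0. m \<theta> * \<theta> ^ k)"
  using coeff_at_infinity_linear_quotient[OF _ assms, of _ k]
  by (simp add: coeff_at_infinity_eq at_infinity_sum at_infinity_smult sum_divide_distrib fls_nth_sum
      flip: times_divide_eq_right)

text \<open>
  The vector consists of the coefficients of the product of \<open>t - \<theta>\<close> over the points \<open>\<theta> \<noteq> \<eta>\<close>.
\<close>

lemma power_vector_separates:
  fixes S :: "real set"
  assumes "finite S" "\<eta> \<in> S" "card S \<le> d"
  shows "\<exists>v. (\<forall>\<theta>\<in>S - {\<eta>}. (\<Sum>i<d. v i * \<theta> ^ i) = 0) \<and> (\<Sum>i<d. v i * \<eta> ^ i) \<noteq> 0"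
proof -
  define V where "V = (\<Prod>\<theta>\<in>S - {\<eta>}. [:-\<theta>, 1:])"
  have "degree V \<le> (\<Sum>\<theta>\<in>S - {\<eta>}. 1)"
    unfolding V_def using assms(1)
    by (intro order_trans[OF degree_prod_sum_le] sum_mono) auto
  moreover have "card (S - {\<eta>}) < d" using assms by (metis card_Diff1_less order_less_le_trans)
  ultimately have "degree V < d" by simp
  then have eval: "(\<Sum>i<d. coeff V i * x ^ i) = poly V x" for x
    unfolding poly_altdef by (intro sum.mono_neutral_right) (auto simp: coeff_eq_0)
  show ?thesis
    by (intro exI[of _ "coeff V"], unfold eval) (use assms(1) in \<open>auto simp: V_def poly_prod\<close>)
qed

section \<open>The Bezoutian of a partial fraction expansion\<close>

text \<open>
  Both sides are linear in the second argument of the Bezoutian. With \<open>r = p / (t - \<theta>)\<close>, the numerator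
  \<open>p(t) r(s) - r(t) p(s)\<close> is \<open>((t - \<theta>) - (s - \<theta>)) r(t) r(s)\<close>.
\<close>

lemma coeff_bezout_quotient_partial_fractions:
  assumes "p \<noteq> 0"
  shows "coeff (coeff (bezout_quotient p (\<Sum>\<theta> | poly p \<theta> = 0. smult (m \<theta>) (p div [:-\<theta>, 1:]))) i) j =
    (\<Sum>\<theta> | poly p \<theta> = 0. m \<theta> * coeff (p div [:-\<theta>, 1:]) i * coeff (p div [:-\<theta>, 1:]) j)"
proof -
  let ?C = "map_poly (\<lambda>c. [:c:]) :: real poly \<Rightarrow> real poly poly"
  let ?S = "{\<theta>. poly p \<theta> = 0}" and ?r = "\<lambda>\<theta>. p div [:-\<theta>, 1:]"
  let ?l = "[:- [:0, 1:], 1:] :: real poly poly"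
  have C_add: "?C (f + g) = ?C f + ?C g" and C_smult: "?C (smult c f) = [:[:c:]:] * ?C f" for f g c
    by (rule poly_eqI, simp add: coeff_map_poly)+
  have C_mult: "?C (f * g) = ?C f * ?C g" for f g
  proof (rule poly_eqI)
    have *: "[:\<Sum>i\<in>A. h i:] = (\<Sum>i\<in>A. [:h i:])" for A :: "nat set" and h :: "nat \<Rightarrow> real"
    proof (induction A rule: infinite_finite_induct)
      case (insert x F)
      then show ?case by (simp flip: insert.IH)
    qed auto
    show "coeff (?C (f * g)) n = coeff (?C f * ?C g) n" for n
      by (simp add: coeff_map_poly coeff_mult * mult.commute)
  qed
  have C_sum: "?C (\<Sum>x\<in>A. f x) = (\<Sum>x\<in>A. ?C (f x))" for f and A :: "real set"
    by (induction A rule: infinite_finite_induct) (simp_all add: C_add)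
  have one: "?C p * [:?r \<theta>:] - ?C (?r \<theta>) * [:p:] = ?l * (?C (?r \<theta>) * [:?r \<theta>:])" if "\<theta> \<in> ?S" for \<theta>
  proof -
    have p: "p = [:-\<theta>, 1:] * ?r \<theta>"
      using that by (intro linear_factor_quotient[symmetric]) simp
    have "[:p:] = [:[:-\<theta>, 1:]:] * [:?r \<theta>:]"
      by (subst p) simp
    moreover have "?C p = [:[:-\<theta>:], 1:] * ?C (?r \<theta>)"
      by (subst p, subst C_mult) (simp add: map_poly_pCons flip: one_pCons)
    ultimately have "?C p * [:?r \<theta>:] - ?C (?r \<theta>) * [:p:] =
        ([:[:-\<theta>:], 1:] - [:[:-\<theta>, 1:]:]) * (?C (?r \<theta>) * [:?r \<theta>:])"
      by (simp only: algebra_simps)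
    also have "[:[:-\<theta>:], 1:] - [:[:-\<theta>, 1:]:] = ?l" by simp
    finally show ?thesis .
  qed
  let ?q = "\<Sum>\<theta>\<in>?S. smult (m \<theta>) (?r \<theta>)"
  have sum_const: "[:\<Sum>\<theta>\<in>A. f \<theta>:] = (\<Sum>\<theta>\<in>A. [:f \<theta>:])" for A :: "real set" and f :: "real \<Rightarrow> real poly"
  proof (induction A rule: infinite_finite_induct)
    case (insert x F)
    then show ?case by (simp flip: insert.IH)
  qed auto
  have "?C p * [:?q:] - ?C ?q * [:p:] =
      (\<Sum>\<theta>\<in>?S. [:[:m \<theta>:]:] * (?C p * [:?r \<theta>:] - ?C (?r \<theta>) * [:p:]))"
    by (simp add: sum_const C_sum C_smult sum_distrib_left sum_distrib_right sum_subtractf right_diff_distrib mult_ac)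
  also have "\<dots> = (\<Sum>\<theta>\<in>?S. ?l * ([:[:m \<theta>:]:] * (?C (?r \<theta>) * [:?r \<theta>:])))"
    by (intro sum.cong refl) (simp only: one mult.left_commute)
  also have "\<dots> = ?l * (\<Sum>\<theta>\<in>?S. [:[:m \<theta>:]:] * (?C (?r \<theta>) * [:?r \<theta>:]))"
    by (simp only: sum_distrib_left)
  finally have "bezout_quotient p ?q = (\<Sum>\<theta>\<in>?S. [:[:m \<theta>:]:] * (?C (?r \<theta>) * [:?r \<theta>:]))"
    unfolding bezout_quotient_def by (simp only: nonzero_mult_div_cancel_left pCons_eq_0_iff one_neq_zero simp_thms not_False_eq_True)
  moreover have "coeff (coeff (?C f * [:g:]) i) j = coeff f i * coeff g j" for f g
    by (simp add: mult.commute[of _ "[:g:]"] coeff_map_poly)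
  ultimately show ?thesis by (simp add: coeff_sum mult_ac)
qed

text \<open>
  If \<open>\<eta>\<close> has multiplicity \<open>k + 1\<close>, then \<open>p / (t - \<eta>)\<close> vanishes at \<open>\<eta>\<close> to order exactly \<open>k\<close> and the other
  quotients \<open>p / (t - \<theta>)\<close> vanish to higher order. The separating functional is therefore the Taylor
  coefficient of order \<open>k\<close> at \<open>\<eta>\<close>.
\<close>

lemma quotient_coeffs_separate:
  fixes p :: "real poly"
  assumes "poly p \<eta> = 0" "p \<noteq> 0"
  shows "\<exists>v. (\<forall>\<theta>\<in>{\<theta>. poly p \<theta> = 0} - {\<eta>}. (\<Sum>i<degree p. v i * coeff (p div [:-\<theta>, 1:]) i) = 0) \<and>
    (\<Sum>i<degree p. v i * coeff (p div [:-\<eta>, 1:]) i) \<noteq> 0"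
proof -
  obtain k f where f: "p = [:-\<eta>, 1:] ^ Suc k * f" "poly f \<eta> \<noteq> 0"
    using root_order_factor[OF assms] by blast
  define v where "v i = coeff (pcompose (monom 1 i) [:\<eta>, 1:]) k" for i
  have v: "(\<Sum>i<degree p. v i * coeff g i) = coeff (pcompose g [:\<eta>, 1:]) k" if "degree g < degree p" for g
  proof -
    have "g = (\<Sum>i<degree p. smult (coeff g i) (monom 1 i))"
      by (rule poly_eqI) (use that in \<open>auto simp: coeff_sum coeff_eq_0 if_distrib cong: if_cong\<close>)
    then have "pcompose g [:\<eta>, 1:] = (\<Sum>i<degree p. smult (coeff g i) (pcompose (monom 1 i) [:\<eta>, 1:]))"
      by (metis (no_types, lifting) pcompose_smult pcompose_sum sum.cong)
    then show ?thesis by (simp add: v_def coeff_sum mult.commute)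
  qed
  have shift: "coeff (pcompose ([:-\<eta>, 1:] ^ j * g) [:\<eta>, 1:]) k =
      (if k < j then 0 else coeff (pcompose g [:\<eta>, 1:]) (k - j))" for j g
  proof -
    have "pcompose ([:-\<eta>, 1:] ^ j) [:\<eta>, 1:] = monom 1 j"
      by (induction j) (simp_all add: pcompose_mult pcompose_pCons pcompose_1 monom_altdef one_pCons del: mult_pCons_left)
    then have "pcompose ([:-\<eta>, 1:] ^ j * g) [:\<eta>, 1:] = monom 1 j * pcompose g [:\<eta>, 1:]"
      by (simp only: pcompose_mult)
    then show ?thesis by (simp add: coeff_monom_mult)
  qed
  have "(\<Sum>i<degree p. v i * coeff (p div [:-\<theta>, 1:]) i) = 0" if "poly p \<theta> = 0" "\<theta> \<noteq> \<eta>" for \<theta>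
  proof -
    have "[:-\<eta>, 1:] ^ Suc k dvd p div [:-\<theta>, 1:]"
      using f(1) that assms(2) by (intro power_dvd_linear_quotient) auto
    then obtain h where "p div [:-\<theta>, 1:] = [:-\<eta>, 1:] ^ Suc k * h" by (rule dvdE)
    moreover have "degree (p div [:-\<theta>, 1:]) < degree p"
      using degree_linear_quotient[OF that(1) assms(2)] by simp
    ultimately show ?thesis
      using shift[of "Suc k" h] by (simp only: v) simp
  qed
  moreover have "(\<Sum>i<degree p. v i * coeff (p div [:-\<eta>, 1:]) i) \<noteq> 0"
  proof -
    have "p div [:-\<eta>, 1:] = [:-\<eta>, 1:] ^ k * f" unfolding f(1) by (rule linear_power_quotient)
    moreover have "degree (p div [:-\<eta>, 1:]) < degree p"
      using degree_linear_quotient[OF assms] by simp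
    ultimately show ?thesis
      using shift[of k f] f(2) by (simp only: v) (simp add: poly_0_coeff_0[symmetric] poly_pcompose)
  qed
  ultimately show ?thesis by (intro exI[of _ v]) auto
qed

section \<open>Restriction of a polynomial to lines and planes\<close>

text \<open>
  The value of \<open>p\<close> at a point with coordinates in any extension field of the reals, used over the
  reals and over the complex numbers. Points are functions, since \<open>rpoly_eval\<close> covers real vectors only.
\<close>

definition peval :: "'n::finite rpoly \<Rightarrow> ('n \<Rightarrow> 'a::real_field) \<Rightarrow> 'a" where
  "peval p z = (\<Sum>m\<in>Poly_Mapping.keys p. of_real (Poly_Mapping.lookup p m) *
     (\<Prod>i\<in>UNIV. z i ^ Poly_Mapping.lookup m i))"

text \<open>
  The univariate polynomial \<open>t \<mapsto> p(a + t b)\<close>.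
\<close>

definition linep :: "'n::finite rpoly \<Rightarrow> ('n \<Rightarrow> 'a::real_field) \<Rightarrow> ('n \<Rightarrow> 'a) \<Rightarrow> 'a poly" where
  "linep p a b = (\<Sum>m\<in>Poly_Mapping.keys p. smult (of_real (Poly_Mapping.lookup p m))
     (\<Prod>i\<in>UNIV. [:a i, b i:] ^ Poly_Mapping.lookup m i))"

text \<open>
  The bivariate polynomial \<open>p(a + t b + s u)\<close>: the outer variable is \<open>s\<close>, the inner one is \<open>t\<close>. Its
  coefficient at \<open>s\<close> is the polynomial \<open>t \<mapsto> (D\<^sub>u p)(a + t b)\<close>, which is how the directional derivative is
  accessed.
\<close>

definition planep ::
  "'n::finite rpoly \<Rightarrow> ('n \<Rightarrow> 'a::real_field) \<Rightarrow> ('n \<Rightarrow> 'a) \<Rightarrow> ('n \<Rightarrow> 'a) \<Rightarrow> 'a poly poly" where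
  "planep p a b u = (\<Sum>m\<in>Poly_Mapping.keys p. [:[:of_real (Poly_Mapping.lookup p m):]:] *
     (\<Prod>i\<in>UNIV. [:[:a i, b i:], [:u i:]:] ^ Poly_Mapping.lookup m i))"

lemma poly_linep: "poly (linep p a b) t = peval p (\<lambda>i. a i + t * b i)"
  by (simp add: linep_def peval_def poly_sum poly_prod poly_power)

lemma poly_planep: "poly (poly (planep p a b u) [:s:]) t = peval p (\<lambda>i. a i + t * b i + s * u i)"
  by (simp add: planep_def peval_def poly_sum poly_prod poly_power algebra_simps)

lemma poly_planep_outer: "poly (planep p a b u) [:s:] = linep p (\<lambda>i. a i + s * u i) b"
proof -
  have "poly (poly (planep p a b u) [:s:]) t = poly (linep p (\<lambda>i. a i + s * u i) b) t" for t
    by (simp add: poly_planep poly_linep add_ac)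
  then show ?thesis by (simp add: poly_eq_poly_eq_iff[symmetric] fun_eq_iff)
qed

lemma planep_inner:
  fixes a :: "'n::finite \<Rightarrow> 'a::real_field"
  shows "map_poly (\<lambda>c. poly c t) (planep p a b u) = linep p (\<lambda>i. a i + t * b i) u"
proof -
  have *: "poly (map_poly (\<lambda>c. poly c t) Q) s = poly (poly Q [:s:]) t" for s and Q :: "'a poly poly"
    by (induction Q) (simp_all add: map_poly_pCons)
  have "poly (map_poly (\<lambda>c. poly c t) (planep p a b u)) s = poly (linep p (\<lambda>i. a i + t * b i) u) s" for s
    by (simp add: * poly_planep poly_linep)
  then show ?thesis by (simp add: poly_eq_poly_eq_iff[symmetric] fun_eq_iff)
qed

lemma poly_coeff_planep: "poly (coeff (planep p a b u) k) t = coeff (linep p (\<lambda>i. a i + t * b i) u) k"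
  by (simp add: planep_inner[symmetric] coeff_map_poly)

lemma peval_real: "peval p (vec_nth x) = rpoly_eval p x"
  by (simp add: peval_def rpoly_eval_def)

lemma peval_of_real: "peval p (\<lambda>i. of_real (vec_nth x i)) = of_real (rpoly_eval p x)"
  by (simp add: peval_def rpoly_eval_def of_real_sum of_real_prod)

lemma peval_homogeneous:
  assumes "homogeneous_of_degree d p"
  shows "peval p (\<lambda>i. c * z i) = c ^ d * peval p z"
proof -
  have "(\<Prod>i\<in>UNIV. (c * z i) ^ Poly_Mapping.lookup m i) =
      c ^ d * (\<Prod>i\<in>UNIV. z i ^ Poly_Mapping.lookup m i)" if "m \<in> Poly_Mapping.keys p" for m
    using assms that
    by (simp add: homogeneous_of_degree_def power_mult_distrib prod.distrib power_sum[symmetric])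
  then show ?thesis
    by (simp add: peval_def sum_distrib_left mult_ac)
qed

lemma rpoly_eval_homogeneous:
  assumes "homogeneous_of_degree d p"
  shows "rpoly_eval p (c *\<^sub>R x) = c ^ d * rpoly_eval p x"
  using peval_homogeneous[OF assms, of c "vec_nth x"] peval_real[of p x] peval_real[of p "c *\<^sub>R x"]
  by (simp add: peval_def rpoly_eval_def)

lemma coeff_mult_degree_bounds:
  fixes f g :: "'a::comm_semiring_0 poly"
  assumes "degree f \<le> m" "degree g \<le> n"
  shows "coeff (f * g) (m + n) = coeff f m * coeff g n"
proof -
  have "coeff (f * g) (m + n) = (\<Sum>i\<le>m + n. coeff f i * coeff g (m + n - i))"
    by (rule coeff_mult)
  also have "\<dots> = (\<Sum>i\<in>{m}. coeff f i * coeff g (m + n - i))"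
  proof (rule sum.mono_neutral_right)
    show "\<forall>i\<in>{..m + n} - {m}. coeff f i * coeff g (m + n - i) = 0"
    proof
      fix i assume "i \<in> {..m + n} - {m}"
      then consider "i > m" | "m + n - i > n" by force
      then show "coeff f i * coeff g (m + n - i) = 0"
        by cases (use assms in \<open>simp_all add: coeff_eq_0\<close>)
    qed
  qed auto
  finally show ?thesis by simp
qed

lemma degree_coeff_prod_linear:
  fixes a b :: "'i \<Rightarrow> 'a::comm_ring_1"
  assumes "finite A"
  shows "degree (\<Prod>i\<in>A. [:a i, b i:] ^ k i) \<le> (\<Sum>i\<in>A. k i) \<and>
    coeff (\<Prod>i\<in>A. [:a i, b i:] ^ k i) (\<Sum>i\<in>A. k i) = (\<Prod>i\<in>A. b i ^ k i)"
  using assms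
proof (induction A)
  case (insert j A)
  have pow: "degree ([:a j, b j:] ^ n) \<le> n \<and> coeff ([:a j, b j:] ^ n) n = b j ^ n" for n
  proof (induction n)
    case (Suc n)
    have "degree ([:a j, b j:] * [:a j, b j:] ^ n) \<le> 1 + n"
      using Suc by (intro order_trans[OF degree_mult_le] add_mono) auto
    moreover have "coeff ([:a j, b j:] * [:a j, b j:] ^ n) (1 + n) = b j * b j ^ n"
      using Suc by (subst coeff_mult_degree_bounds) (auto simp del: mult_pCons_left)
    ultimately show ?case by simp
  qed simp
  let ?f = "[:a j, b j:] ^ k j" and ?g = "\<Prod>i\<in>A. [:a i, b i:] ^ k i"
  have "degree (?f * ?g) \<le> k j + (\<Sum>i\<in>A. k i)"
    using pow insert.IH by (intro order_trans[OF degree_mult_le] add_mono) auto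
  moreover have "coeff (?f * ?g) (k j + (\<Sum>i\<in>A. k i)) = b j ^ k j * (\<Prod>i\<in>A. b i ^ k i)"
    using pow insert.IH by (subst coeff_mult_degree_bounds) auto
  ultimately show ?case using insert.hyps by simp
qed simp

lemma linep_degree:
  assumes "homogeneous_of_degree d p"
  shows "degree (linep p a b) \<le> d" "coeff (linep p a b) d = peval p b"
proof -
  have *: "degree (\<Prod>i\<in>UNIV. [:a i, b i:] ^ Poly_Mapping.lookup m i) \<le> d"
    "coeff (\<Prod>i\<in>UNIV. [:a i, b i:] ^ Poly_Mapping.lookup m i) d =
      (\<Prod>i\<in>UNIV. b i ^ Poly_Mapping.lookup m i)" if "m \<in> Poly_Mapping.keys p" for m
    using degree_coeff_prod_linear[of UNIV a b "Poly_Mapping.lookup m"] assms that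
    by (auto simp: homogeneous_of_degree_def)
  show "degree (linep p a b) \<le> d"
    unfolding linep_def
    by (intro degree_sum_le order_trans[OF degree_smult_le] *) auto
  show "coeff (linep p a b) d = peval p b"
    by (simp add: linep_def peval_def coeff_sum *)
qed

text \<open>
  The coefficient of \<open>t\<^sup>j\<close> in \<open>p(a + t b + s u)\<close> is, for \<open>j \<ge> d\<close>, independent of \<open>s\<close>. With \<open>k = 1\<close> this says
  that \<open>(D\<^sub>u p)(a + t b)\<close> has degree less than \<open>d\<close> in \<open>t\<close>.
\<close>

lemma coeff_planep_degree:
  fixes a :: "'n::finite \<Rightarrow> 'a::real_field"
  assumes "homogeneous_of_degree d p" "j \<ge> d" "k > 0"
  shows "coeff (coeff (planep p a b u) k) j = 0"
proof -
  have *: "poly (map_poly (\<lambda>c. coeff c j) Q) s = coeff (poly Q [:s:]) j" for s and Q :: "'a poly poly"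
    by (induction Q) (simp_all add: map_poly_pCons)
  have "coeff (linep p c b) j = (if j = d then peval p b else 0)" for c
    using linep_degree[OF assms(1), of c b] assms(2) by (auto intro: coeff_eq_0)
  then have "poly (map_poly (\<lambda>c. coeff c j) (planep p a b u)) s = poly [:if j = d then peval p b else 0:] s" for s
    by (simp add: * poly_planep_outer)
  then have "map_poly (\<lambda>c. coeff c j) (planep p a b u) = [:if j = d then peval p b else 0:]"
    by (simp add: poly_eq_poly_eq_iff[symmetric] fun_eq_iff)
  then have "coeff (map_poly (\<lambda>c. coeff c j) (planep p a b u)) k = 0"
    using assms(3) by (cases k) auto
  then show ?thesis by (simp add: coeff_map_poly)
qed

lemma line_poly_eval: "line_poly (rpoly_eval p) x e = linep p (vec_nth x) (vec_nth e)"
proof (rule line_poly_eqI)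
  fix t show "poly (linep p (vec_nth x) (vec_nth e)) t = rpoly_eval p (x + t *\<^sub>R e)"
    by (simp add: poly_linep peval_real[symmetric] peval_def)
qed

lemma line_poly_deriv:
  "line_poly (dir_deriv u (rpoly_eval p)) x e = coeff (planep p (vec_nth x) (vec_nth e) (vec_nth u)) 1"
proof (rule line_poly_eqI)
  fix t
  let ?L = "line_poly (rpoly_eval p) (x + t *\<^sub>R e) u"
  have "((\<lambda>s. rpoly_eval p (x + t *\<^sub>R e + s *\<^sub>R u)) has_field_derivative poly (pderiv ?L) 0) (at 0)"
    using poly_DERIV[of ?L 0] by (simp add: poly_line_poly_eval)
  then have "dir_deriv u (rpoly_eval p) (x + t *\<^sub>R e) = coeff ?L 1"
    by (simp add: dir_deriv_def DERIV_imp_deriv poly_0_coeff_0 coeff_pderiv)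
  then show "poly (coeff (planep p (vec_nth x) (vec_nth e) (vec_nth u)) 1) t =
      dir_deriv u (rpoly_eval p) (x + t *\<^sub>R e)"
    by (simp add: poly_coeff_planep line_poly_eval vector_add_component[abs_def] vector_scaleR_component)
qed

lemma complex_poly_eqI_real:
  fixes P Q :: "complex poly"
  assumes "\<And>t::real. poly P (of_real t) = poly Q (of_real t)"
  shows "P = Q"
proof (rule ccontr)
  assume "P \<noteq> Q"
  then have "finite {z. poly (P - Q) z = 0}" by (intro poly_roots_finite) simp
  moreover have "range complex_of_real \<subseteq> {z. poly (P - Q) z = 0}" using assms by auto
  ultimately have "finite (range complex_of_real)" by (rule finite_subset[rotated])
  then have "finite (UNIV :: real set)" by (rule finite_imageD) (simp add: inj_on_def)
  then show False by (simp add: infinite_UNIV_char_0)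
qed

text \<open>
  A real vector regarded as a complex point.
\<close>

abbreviation cvec :: "real ^ 'n \<Rightarrow> 'n \<Rightarrow> complex" where
  "cvec x \<equiv> \<lambda>i. of_real (vec_nth x i)"

lemma linep_cvec:
  "linep p (cvec x) (cvec e) = map_poly of_real (line_poly (rpoly_eval p) x e)"
proof (rule complex_poly_eqI_real)
  fix t
  have "peval p (cvec (x + t *\<^sub>R e)) = of_real (rpoly_eval p (x + t *\<^sub>R e))" by (rule peval_of_real)
  then show "poly (linep p (cvec x) (cvec e)) (of_real t) =
      poly (map_poly of_real (line_poly (rpoly_eval p) x e)) (of_real t)"
    by (simp add: poly_linep poly_map_poly_of_real poly_line_poly_eval)
qed

lemma coeff_planep_cvec:
  "coeff (planep p (cvec x) (cvec e) (cvec u)) k =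
    map_poly of_real (coeff (planep p (vec_nth x) (vec_nth e) (vec_nth u)) k)"
proof (rule complex_poly_eqI_real)
  fix t
  have "coeff (linep p (cvec (x + t *\<^sub>R e)) (cvec u)) k =
      of_real (coeff (linep p (vec_nth (x + t *\<^sub>R e)) (vec_nth u)) k)"
    unfolding linep_cvec line_poly_eval by (simp add: coeff_map_poly)
  then show "poly (coeff (planep p (cvec x) (cvec e) (cvec u)) k) (of_real t) =
      poly (map_poly of_real (coeff (planep p (vec_nth x) (vec_nth e) (vec_nth u)) k)) (of_real t)"
    by (simp add: poly_coeff_planep poly_map_poly_of_real vector_add_component[abs_def])
qed

section \<open>Hyperbolic polynomials\<close>

context
  fixes p :: "'n::finite rpoly" and e :: "real ^ 'n" and d :: nat
  assumes hyp: "p \<in> hyperbolic_polys d e"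
begin

lemma homogeneous: "homogeneous_of_degree d p" and eval_e_pos: "rpoly_eval p e > 0"
  and line_real: "only_real_zeros (line_poly (rpoly_eval p) x e)"
  using hyp by (auto simp: hyperbolic_polys_def)

lemma line_degree: "degree (line_poly (rpoly_eval p) x e) = d"
  and line_nonzero: "line_poly (rpoly_eval p) x e \<noteq> 0"
proof -
  have "coeff (line_poly (rpoly_eval p) x e) d \<noteq> 0"
    using eval_e_pos by (simp add: line_poly_eval peval_real linep_degree(2)[OF homogeneous])
  then show "degree (line_poly (rpoly_eval p) x e) = d" "line_poly (rpoly_eval p) x e \<noteq> 0"
    using linep_degree(1)[OF homogeneous, of "vec_nth x" "vec_nth e"] le_degree
    by (auto simp: line_poly_eval intro: antisym)
qed

text \<open>
  Membership in the cone, without the sorted list of eigenvalues; that this list has length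
  \<open>d\<close> is where real-rootedness enters.
\<close>

lemma hyperbolicity_cone_iff:
  "u \<in> hyperbolicity_cone d p e \<longleftrightarrow> (\<forall>r. rpoly_eval p (r *\<^sub>R e - u) = 0 \<longrightarrow> r \<ge> 0)"
proof -
  let ?L = "line_poly (rpoly_eval p) (- u) e"
  let ?xs = "rev (sorted_list_of_multiset (proots ?L))"
  have "length ?xs = size (mset ?xs)" by (rule size_mset[symmetric])
  then have "length ?xs = d"
    using only_real_zeros_size_proots[OF line_real line_nonzero, of "- u"] line_degree by simp
  then have "u \<in> hyperbolicity_cone d p e \<longleftrightarrow> (\<forall>r\<in>set ?xs. r \<ge> 0)"
    unfolding hyperbolicity_cone_def hyp_eigenvalue_def all_set_conv_all_nth by simp
  also have "set ?xs = {r. poly ?L r = 0}"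
    using line_nonzero by simp
  finally show ?thesis by (simp add: poly_line_poly_eval)
qed

lemma peval_nonreal_nonzero:
  assumes "Im t \<noteq> 0"
  shows "peval p (\<lambda>i. cvec x i + t * cvec e i) \<noteq> 0"
proof
  assume "peval p (\<lambda>i. cvec x i + t * cvec e i) = 0"
  then have "t \<in> \<real>"
    using line_real[of x] by (simp add: only_real_zeros_def linep_cvec[symmetric] poly_linep)
  with assms show False by (auto elim: Reals_cases)
qed

text \<open>
  The base point \<open>x = 0\<close>: by homogeneity, \<open>p(t e + s u) = 0\<close> means that \<open>- t / s\<close> is an eigenvalue
  of \<open>u\<close>.
\<close>

lemma peval_plane_nonzero:
  assumes u: "\<And>r. rpoly_eval p (r *\<^sub>R e - u) = 0 \<Longrightarrow> r \<ge> 0"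
    and "Im t > 0" "Im s \<ge> 0"
  shows "peval p (\<lambda>i. t * cvec e i + s * cvec u i) \<noteq> 0"
proof (cases "s = 0")
  case True
  then show ?thesis
    using peval_nonreal_nonzero[of t 0] assms(2) by simp
next
  case False
  show ?thesis
  proof
    assume z: "peval p (\<lambda>i. t * cvec e i + s * cvec u i) = 0"
    let ?\<tau> = "- t / s"
    have "(\<lambda>i. t * cvec e i + s * cvec u i) = (\<lambda>i. - s * (cvec (- u) i + ?\<tau> * cvec e i))"
      using False by (simp add: field_simps fun_eq_iff)
    then have z: "peval p (\<lambda>i. cvec (- u) i + ?\<tau> * cvec e i) = 0"
      using z False peval_homogeneous[OF homogeneous, of "- s" "\<lambda>i. cvec (- u) i + ?\<tau> * cvec e i"] by simp
    then have "Im ?\<tau> = 0" using peval_nonreal_nonzero[of ?\<tau> "- u"] by blast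
    then obtain r where r: "?\<tau> = of_real r" by (metis complex_is_Real_iff Reals_cases)
    have "peval p (cvec (r *\<^sub>R e - u)) = 0"
      using z unfolding r by (simp add: algebra_simps)
    then have "rpoly_eval p (r *\<^sub>R e - u) = 0" by (simp only: peval_of_real of_real_eq_0_iff)
    then have "r \<ge> 0" by (rule u)
    have "- t = of_real r * s" using r False by (simp add: field_simps)
    then have "t = - (of_real r * s)" by (metis minus_minus)
    then have "Im t = - (r * Im s)" by simp
    with \<open>r \<ge> 0\<close> assms(2,3) show False by (simp add: mult_nonneg_nonneg less_le_not_le)
  qed
qed

text \<open>
  For \<open>u\<close> in the open cone, \<open>p\<close> does not vanish at \<open>x + t e + s u\<close> when \<open>t\<close> is in the open and \<open>s\<close> in the
  closed upper half-plane. The path \<open>b \<mapsto> p(b x + t e + s u)\<close> of polynomials in \<open>s\<close> has the constant leading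
  coefficient \<open>p(u) \<noteq> 0\<close>, and hyperbolicity excludes real zeros \<open>s\<close> because \<open>t\<close> is not real.
\<close>
lemma peval_halfplanes_nonzero_open:
  assumes u: "\<And>r. rpoly_eval p (r *\<^sub>R e - u) = 0 \<Longrightarrow> r > 0"
    and t: "Im t > 0" and s: "Im s \<ge> 0"
  shows "peval p (\<lambda>i. cvec x i + t * cvec e i + s * cvec u i) \<noteq> 0"
proof -
  define P where "P = (\<lambda>b::real. linep p (\<lambda>i. t * cvec e i + of_real b * cvec x i) (cvec u))"
  have "rpoly_eval p (- u) \<noteq> 0" using u[of 0] by auto
  then have u0: "rpoly_eval p u \<noteq> 0"
    using rpoly_eval_homogeneous[OF homogeneous, of "- 1" u] by auto
  have lead: "coeff (P b) d = of_real (rpoly_eval p u)" for b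
    by (simp add: P_def peval_of_real linep_degree(2)[OF homogeneous])
  have "poly (P 1) s \<noteq> 0"
  proof (rule roots_stay_below_real_axis[where n = d and c = "of_real (rpoly_eval p u)"])
    show "degree (P b) = d" for b
    proof (rule antisym)
      show "degree (P b) \<le> d" unfolding P_def by (rule linep_degree(1)[OF homogeneous])
      show "d \<le> degree (P b)" using lead[of b] u0 by (intro le_degree) simp
    qed
    show "continuous_on {0..1} (\<lambda>b. coeff (P b) i)" for i
      unfolding P_def poly_coeff_planep[symmetric] by (intro continuous_intros)
    show "poly (P b) (of_real y) \<noteq> 0" for b y
    proof -
      have "peval p (\<lambda>i. cvec (b *\<^sub>R x + y *\<^sub>R u) i + t * cvec e i) \<noteq> 0"
        using t by (intro peval_nonreal_nonzero) simp
      then show ?thesis by (simp add: P_def poly_linep algebra_simps)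
    qed
    show "poly (P 0) z \<noteq> 0" if "Im z \<ge> 0" for z
      using peval_plane_nonzero[OF less_imp_le[OF u] t that] by (simp add: P_def poly_linep)
  qed (use lead u0 s in auto)
  then show ?thesis by (simp add: P_def poly_linep algebra_simps)
qed

text \<open>
  For the closed cone, replace \<open>u\<close> by \<open>u + \<epsilon> e\<close> and \<open>t\<close> by \<open>t - \<epsilon> s\<close>; this does not change the point, and
  a small \<open>\<epsilon> > 0\<close> keeps \<open>t - \<epsilon> s\<close> in the upper half-plane.
\<close>

lemma peval_halfplanes_nonzero:
  assumes u: "u \<in> hyperbolicity_cone d p e"
    and t: "Im t > 0" and s: "Im s \<ge> 0"
  shows "peval p (\<lambda>i. cvec x i + t * cvec e i + s * cvec u i) \<noteq> 0"
proof -
  define \<epsilon> where "\<epsilon> = Im t / (2 * (Im s + 1))"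
  have \<epsilon>: "\<epsilon> > 0" using t s by (simp add: \<epsilon>_def)
  have "\<epsilon> * Im s \<le> \<epsilon> * (Im s + 1)" using \<epsilon> by simp
  also have "\<dots> = Im t / 2" using s by (simp add: \<epsilon>_def field_simps)
  finally have "Im (t - of_real \<epsilon> * s) > 0" using t by simp
  moreover have "r > 0" if "rpoly_eval p (r *\<^sub>R e - (u + \<epsilon> *\<^sub>R e)) = 0" for r
  proof -
    have "rpoly_eval p ((r - \<epsilon>) *\<^sub>R e - u) = 0" using that by (simp add: algebra_simps)
    then have "r - \<epsilon> \<ge> 0" using u hyperbolicity_cone_iff by blast
    then show ?thesis using \<epsilon> by simp
  qed
  ultimately have "peval p (\<lambda>i. cvec x i + (t - of_real \<epsilon> * s) * cvec e i + s * cvec (u + \<epsilon> *\<^sub>R e) i) \<noteq> 0"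
    using s by (intro peval_halfplanes_nonzero_open)
  then show ?thesis by (simp add: algebra_simps)
qed

text \<open>
  The rational function \<open>D\<^sub>u p\<^sub>x / p\<^sub>x\<close> maps the upper half-plane to the closed lower half-plane: at a point
  \<open>t\<close> it is the logarithmic derivative of \<open>s \<mapsto> p(x + t e + s u)\<close> at \<open>0\<close>.
\<close>

lemma im_line_deriv_nonpos:
  assumes "u \<in> hyperbolicity_cone d p e" "Im t > 0"
  shows "Im (poly (map_poly of_real (line_poly (dir_deriv u (rpoly_eval p)) x e)) t *
    cnj (poly (map_poly of_real (line_poly (rpoly_eval p) x e)) t)) \<le> 0"
proof -
  define G where "G = linep p (\<lambda>i. cvec x i + t * cvec e i) (cvec u)"
  have "poly G s \<noteq> 0" if "Im s \<ge> 0" for s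
    using peval_halfplanes_nonzero[OF assms that] by (simp add: G_def poly_linep)
  then have "Im (poly (pderiv G) 0 * cnj (poly G 0)) \<le> 0" by (rule im_log_derivative_nonpos)
  moreover have "poly (pderiv G) 0 = poly (map_poly of_real (line_poly (dir_deriv u (rpoly_eval p)) x e)) t"
    by (simp add: line_poly_deriv coeff_planep_cvec[symmetric] poly_coeff_planep G_def
        poly_0_coeff_0 coeff_pderiv)
  moreover have "poly G 0 = poly (map_poly of_real (line_poly (rpoly_eval p) x e)) t"
    by (simp add: G_def linep_cvec[symmetric] poly_linep)
  ultimately show ?thesis by simp
qed

section \<open>Residues, eigenvalues and the two matrices\<close>

lemma coeff_line_deriv_high:
  "j \<ge> d \<Longrightarrow> coeff (line_poly (dir_deriv u (rpoly_eval p)) x e) j = 0"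
  unfolding line_poly_deriv by (rule coeff_planep_degree[OF homogeneous]) auto

lemma cone_partial_fractions:
  assumes u: "u \<in> hyperbolicity_cone d p e"
  shows "\<exists>m. (\<forall>\<theta>. m \<theta> \<ge> 0) \<and> line_poly (dir_deriv u (rpoly_eval p)) x e =
    (\<Sum>\<theta> | poly (line_poly (rpoly_eval p) x e) \<theta> = 0.
      smult (m \<theta>) (line_poly (rpoly_eval p) x e div [:-\<theta>, 1:]))"
proof -
  let ?P = "line_poly (rpoly_eval p) x e" and ?Q = "line_poly (dir_deriv u (rpoly_eval p)) x e"
  have "\<exists>m\<ge>0. poly ?P \<theta> = 0 \<longrightarrow> (\<exists>k f g. ?P = [:-\<theta>, 1:] ^ Suc k * f \<and> poly f \<theta> \<noteq> 0 \<and>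
      ?Q = [:-\<theta>, 1:] ^ k * g \<and> poly g \<theta> = m * poly f \<theta>)" for \<theta>
  proof (cases "poly ?P \<theta> = 0")
    case True
    obtain k f where f: "?P = [:-\<theta>, 1:] ^ Suc k * f" "poly f \<theta> \<noteq> 0"
      using root_order_factor[OF True line_nonzero] by blast
    obtain g where g: "?Q = [:-\<theta>, 1:] ^ k * g" "poly g \<theta> * poly f \<theta> \<ge> 0"
      using simple_pole_of_half_plane[OF f im_line_deriv_nonpos[OF u]] by blast
    have "poly g \<theta> / poly f \<theta> \<ge> 0"
      using g(2) by (simp add: zero_le_divide_iff zero_le_mult_iff)
    moreover have "poly g \<theta> = poly g \<theta> / poly f \<theta> * poly f \<theta>" using f(2) by simp
    ultimately show ?thesis using f g(1) by blast
  qed auto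
  then obtain m where m: "\<And>\<theta>. m \<theta> \<ge> 0" "\<And>\<theta>. poly ?P \<theta> = 0 \<Longrightarrow>
      \<exists>k f g. ?P = [:-\<theta>, 1:] ^ Suc k * f \<and> poly f \<theta> \<noteq> 0 \<and>
        ?Q = [:-\<theta>, 1:] ^ k * g \<and> poly g \<theta> = m \<theta> * poly f \<theta>"
    by metis
  have "?Q = (\<Sum>\<theta> | poly ?P \<theta> = 0. smult (m \<theta>) (?P div [:-\<theta>, 1:]))"
    by (rule partial_fractions[OF line_real line_nonzero _ m(2)])
      (simp_all only: line_degree coeff_line_deriv_high)
  with m(1) show ?thesis by blast
qed

text \<open>
  Euler's identity along a line: differentiate \<open>p((1 + s) u + t e) = (1 + s)\<^sup>d p(u + (t / (1 + s)) e)\<close> at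
  \<open>s = 0\<close>.
\<close>

lemma line_deriv_self:
  "line_poly (dir_deriv u (rpoly_eval p)) u e =
    smult (of_nat d) (line_poly (rpoly_eval p) u e) -
      [:0, 1:] * pderiv (line_poly (rpoly_eval p) u e)"
proof (rule line_poly_eqI)
  fix t
  let ?P = "line_poly (rpoly_eval p) u e"
  have "((\<lambda>s. (1 + s) ^ d * poly ?P (t / (1 + s))) has_field_derivative
      of_nat d * poly ?P t - t * poly (pderiv ?P) t) (at 0)"
    by (auto intro!: derivative_eq_intros simp: algebra_simps)
  moreover have "eventually (\<lambda>s. (1 + s) ^ d * poly ?P (t / (1 + s)) =
      rpoly_eval p (u + t *\<^sub>R e + s *\<^sub>R u)) (nhds 0)"
  proof -
    have "eventually (\<lambda>s::real. s \<in> {-1<..}) (nhds 0)" by (intro eventually_nhds_in_open) auto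
    then show ?thesis
    proof eventually_elim
      case (elim s)
      then have s: "1 + s \<noteq> 0" by auto
      have "(1 + s) *\<^sub>R (u + (t / (1 + s)) *\<^sub>R e) = u + t *\<^sub>R e + s *\<^sub>R u"
        using s by (simp add: scaleR_add_right scaleR_add_left)
      then show ?case
        using rpoly_eval_homogeneous[OF homogeneous, of "1 + s" "u + (t / (1 + s)) *\<^sub>R e"]
        by (simp add: poly_line_poly_eval)
    qed
  qed
  ultimately have "((\<lambda>s. rpoly_eval p (u + t *\<^sub>R e + s *\<^sub>R u)) has_field_derivative
      of_nat d * poly ?P t - t * poly (pderiv ?P) t) (at 0)"
    by (subst (asm) DERIV_cong_ev) auto
  then show "poly (smult (of_nat d) ?P - [:0, 1:] * pderiv ?P) t =
      dir_deriv u (rpoly_eval p) (u + t *\<^sub>R e)"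
    by (simp add: dir_deriv_def DERIV_imp_deriv)
qed

text \<open>
  At the base point \<open>x = u\<close> the residues are explicit: the one at \<open>\<theta>\<close> is the eigenvalue \<open>- \<theta>\<close> of \<open>u\<close>
  times its multiplicity.
\<close>

lemma self_partial_fractions:
  "line_poly (dir_deriv u (rpoly_eval p)) u e =
    (\<Sum>\<theta> | poly (line_poly (rpoly_eval p) u e) \<theta> = 0.
      smult (- \<theta> * real (order \<theta> (line_poly (rpoly_eval p) u e)))
        (line_poly (rpoly_eval p) u e div [:-\<theta>, 1:]))"
proof (rule partial_fractions[OF line_real line_nonzero])
  let ?P = "line_poly (rpoly_eval p) u e"
  show "coeff (line_poly (dir_deriv u (rpoly_eval p)) u e) j = 0" if "degree ?P \<le> j" for j
    using that by (simp add: line_degree coeff_line_deriv_high)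
  fix \<theta> assume \<theta>: "poly ?P \<theta> = 0"
  obtain k f where f: "?P = [:-\<theta>, 1:] ^ Suc k * f" "poly f \<theta> \<noteq> 0" "order \<theta> ?P = Suc k"
    using root_order_factor[OF \<theta> line_nonzero] by blast
  define L where "L = [:-\<theta>, 1:]"
  define g where "g = smult (of_nat d) (L * f) -
    [:0, 1:] * (smult (of_nat (Suc k)) f + L * pderiv f)"
  have "pderiv L = 1" by (simp add: L_def pderiv_pCons)
  have P: "?P = L ^ k * (L * f)" unfolding f(1) L_def by (simp only: power_Suc2 mult.assoc)
  have "pderiv ?P = L ^ k * (smult (of_nat (Suc k)) f + L * pderiv f)"
    unfolding f(1) L_def[symmetric] pderiv_mult pderiv_power_Suc \<open>pderiv L = 1\<close>
    by (simp add: algebra_simps)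
  then have "line_poly (dir_deriv u (rpoly_eval p)) u e = L ^ k * g"
    unfolding line_deriv_self g_def by (simp add: P right_diff_distrib mult_ac)
  moreover have "poly g \<theta> = (- \<theta> * real (order \<theta> ?P)) * poly f \<theta>"
    unfolding f(3) by (simp add: g_def L_def algebra_simps)
  ultimately show "\<exists>k f g. ?P = [:-\<theta>, 1:] ^ Suc k * f \<and> poly f \<theta> \<noteq> 0 \<and>
      line_poly (dir_deriv u (rpoly_eval p)) u e = [:-\<theta>, 1:] ^ k * g \<and>
      poly g \<theta> = (- \<theta> * real (order \<theta> ?P)) * poly f \<theta>"
    using f(1,2) unfolding L_def by blast
qed

lemma cone_if_weights_nonneg:
  assumes "\<And>\<theta>. poly (line_poly (rpoly_eval p) u e) \<theta> = 0 \<Longrightarrow>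
    - \<theta> * real (order \<theta> (line_poly (rpoly_eval p) u e)) \<ge> 0"
  shows "u \<in> hyperbolicity_cone d p e"
  unfolding hyperbolicity_cone_iff
proof (intro allI impI)
  let ?P = "line_poly (rpoly_eval p) u e"
  fix r assume "rpoly_eval p (r *\<^sub>R e - u) = 0"
  then have root: "poly ?P (- r) = 0"
    using rpoly_eval_homogeneous[OF homogeneous, of "- 1" "r *\<^sub>R e - u"]
    by (simp add: poly_line_poly_eval)
  then have "order (- r) ?P > 0" using line_nonzero by (simp add: order_gt_0_iff)
  then show "r \<ge> 0" using assms[OF root] by (simp add: zero_le_mult_iff)
qed

lemma hermite_mat_weighted:
  assumes "line_poly (dir_deriv u (rpoly_eval p)) x e =
    (\<Sum>\<theta> | poly (line_poly (rpoly_eval p) x e) \<theta> = 0.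
      smult (m \<theta>) (line_poly (rpoly_eval p) x e div [:-\<theta>, 1:]))"
  shows "hermite_mat d p e x u = mat d d (\<lambda>(i, j).
    \<Sum>\<theta> | poly (line_poly (rpoly_eval p) x e) \<theta> = 0. m \<theta> * \<theta> ^ i * \<theta> ^ j)"
  unfolding hermite_mat_def assms Suc_eq_plus1[symmetric]
    coeff_at_infinity_partial_fractions[OF line_nonzero]
  by (simp add: power_add mult.assoc)

lemma bezoutian_mat_weighted:
  assumes "line_poly (dir_deriv u (rpoly_eval p)) x e =
    (\<Sum>\<theta> | poly (line_poly (rpoly_eval p) x e) \<theta> = 0.
      smult (m \<theta>) (line_poly (rpoly_eval p) x e div [:-\<theta>, 1:]))"
  shows "bezoutian_mat d p e x u = mat d d (\<lambda>(i, j).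
    \<Sum>\<theta> | poly (line_poly (rpoly_eval p) x e) \<theta> = 0.
      m \<theta> * coeff (line_poly (rpoly_eval p) x e div [:-\<theta>, 1:]) i *
        coeff (line_poly (rpoly_eval p) x e div [:-\<theta>, 1:]) j)"
  unfolding bezoutian_mat_def assms
    coeff_bezout_quotient_partial_fractions[OF line_nonzero] ..

lemma hermite_bezoutian_psd_if_cone:
  assumes "u \<in> hyperbolicity_cone d p e"
  shows "psd_mat d (hermite_mat d p e x u)" "psd_mat d (bezoutian_mat d p e x u)"
proof -
  obtain m where m: "\<And>\<theta>. m \<theta> \<ge> 0" "line_poly (dir_deriv u (rpoly_eval p)) x e =
    (\<Sum>\<theta> | poly (line_poly (rpoly_eval p) x e) \<theta> = 0.
      smult (m \<theta>) (line_poly (rpoly_eval p) x e div [:-\<theta>, 1:]))"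
    using cone_partial_fractions[OF assms, of x] by blast
  show "psd_mat d (hermite_mat d p e x u)"
    unfolding hermite_mat_weighted[OF m(2)] by (rule psd_mat_weighted_squares) (rule m(1))
  show "psd_mat d (bezoutian_mat d p e x u)"
    unfolding bezoutian_mat_weighted[OF m(2)] by (rule psd_mat_weighted_squares) (rule m(1))
qed

lemma cone_if_hermite_psd:
  assumes "psd_mat d (hermite_mat d p e u u)"
  shows "u \<in> hyperbolicity_cone d p e"
proof (rule cone_if_weights_nonneg)
  let ?P = "line_poly (rpoly_eval p) u e"
  fix \<eta> assume \<eta>: "poly ?P \<eta> = 0"
  have fin: "finite {\<theta>. poly ?P \<theta> = 0}" using line_nonzero by (rule poly_roots_finite)
  have "card {\<theta>. poly ?P \<theta> = 0} \<le> d"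
    using card_poly_roots_bound[OF line_nonzero] line_degree by metis
  then obtain v where v: "\<forall>\<theta>\<in>{\<theta>. poly ?P \<theta> = 0} - {\<eta>}. (\<Sum>i<d. v i * \<theta> ^ i) = 0"
      "(\<Sum>i<d. v i * \<eta> ^ i) \<noteq> 0"
    using power_vector_separates[OF fin, of \<eta> d] \<eta> by auto
  show "- \<eta> * real (order \<eta> ?P) \<ge> 0"
    using psd_mat_weight_nonneg[OF assms[unfolded hermite_mat_weighted[OF self_partial_fractions]] fin, of \<eta> v] v \<eta>
    by auto
qed

lemma cone_if_bezoutian_psd:
  assumes "psd_mat d (bezoutian_mat d p e u u)"
  shows "u \<in> hyperbolicity_cone d p e"
proof (rule cone_if_weights_nonneg)
  let ?P = "line_poly (rpoly_eval p) u e"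
  fix \<eta> assume \<eta>: "poly ?P \<eta> = 0"
  have fin: "finite {\<theta>. poly ?P \<theta> = 0}" using line_nonzero by (rule poly_roots_finite)
  obtain v where v: "\<forall>\<theta>\<in>{\<theta>. poly ?P \<theta> = 0} - {\<eta>}. (\<Sum>i<d. v i * coeff (?P div [:-\<theta>, 1:]) i) = 0"
      "(\<Sum>i<d. v i * coeff (?P div [:-\<eta>, 1:]) i) \<noteq> 0"
    using quotient_coeffs_separate[OF \<eta> line_nonzero] line_degree by metis
  show "- \<eta> * real (order \<eta> ?P) \<ge> 0"
    using psd_mat_weight_nonneg[OF assms[unfolded bezoutian_mat_weighted[OF self_partial_fractions]] fin, of \<eta> v] v \<eta>
    by auto
qed

end

theorem theorem3p7:
  fixes p :: "'n::finite rpoly" and e :: "real ^ 'n" and d :: nat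
  assumes "p \<in> hyperbolic_polys d e"
  shows "hyperbolicity_cone d p e = {u. \<forall>x. psd_mat d (hermite_mat d p e x u)} \<and>
    {u. \<forall>x. psd_mat d (hermite_mat d p e x u)} =
      {u. \<forall>x. psd_mat d (bezoutian_mat d p e x u)}"
  using hermite_bezoutian_psd_if_cone[OF assms] cone_if_hermite_psd[OF assms] cone_if_bezoutian_psd[OF assms]
  by blast

end
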